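(* Statement (C) below implies statement (O) below. (C) For all integers $n\ge 2$, $k\ge 2$, $d>1$, $s\ge 1$, if $g_1,\dots,g_s$ are generic forms of degree $d$ in $n$ variables over $\mathbb{C}$, then the ideal $(g_1^{k-1},\dots,g_s^{k-1})$ is Hilbert generic. (O) For all integers $k,n,d\ge 2$, $$\mathrm{rk}^\circ_k(n,kd)=\begin{cases}\min\left\{s\ge 1 \;\middle|\; s\binom{d+n-1}{n-1}-\binom{s}{2}\ge\binom{2d+n-1}{n-1}\right\}, & k=2,\\[2mm] \min\left\{s\ge 1 \;\middle|\; s\binom{d+n-1}{n-1}\ge\binom{kd+n-1}{n-1}\right\}, & k\ge 3.\end{cases}$$
   Context: Let $S=\bigoplus_{d\ge 0}S_d$ be the standard graded polynomial ring in $n$ variables over $\mathbb{C}$. The $k$-rank of $f\in S_{kd}$ is the smallest $s$ such that $f=g_1^k+\dots+g_s^k$ with $g_i\in S_d$. The generic $k$-rank $\mathrm{rk}^\circ_k(n,kd)$ is the $k$-rank of a general form in $S_{kd}$; equivalently, the smallest $s$ such that the set of sums $g_1^k+\dots+g_s^k$ with $g_i\in S_d$ is Zariski dense in $S_{kd}$. For a homogeneous ideal $I\subset S$, the Hilbert series is $\mathrm{HS}_{S/I}(t)=\sum_{i\ge 0}\dim_{\mathbb{C}}[S/I]_i\,t^i$. An ideal $I=(h_1,\dots,h_s)$ generated by forms of degrees $d_1,\dots,d_s$ is called Hilbert generic if $$\mathrm{HS}_{S/I}(t)=\left\lceil\frac{\prod_{i=1}^s(1-t^{d_i})}{(1-t)^n}\right\rceil,$$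 where $\lceil\cdot\rceil$ denotes truncation of a power series at its first non-positive coefficient: $\lceil\sum a_it^i\rceil=\sum b_it^i$ with $b_i=a_i$ if $a_j>0$ for all $j\le i$, and $b_i=0$ otherwise. "Generic" means for all tuples $(g_1,\dots,g_s)$ in some nonempty Zariski open subset of the space $S_d^s$ of tuples of forms. *)

theory Defs
  imports
    "HOL-Analysis.Abstract_Topology"
    "HOL-Library.Poly_Mapping"
    "HOL-Library.FuncSet"
    "HOL-Computational_Algebra.Formal_Power_Series"
begin

section \<open>Polynomials and forms over the complex numbers\<close>

text \<open>
  A polynomial in variables indexed by the naturals is a finitely supported function from
  exponent vectors to coefficients; the polynomial ring in \<open>n\<close> variables is the subring of those
  polynomials in which only the variables with index below \<open>n\<close> occur.
\<close>

type_synonym cpoly = "(nat \<Rightarrow>\<^sub>0 nat) \<Rightarrow>\<^sub>0 complex"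

definition mono_degree :: "(nat \<Rightarrow>\<^sub>0 nat) \<Rightarrow> nat" where
  "mono_degree m = (\<Sum>v\<in>Poly_Mapping.keys m. Poly_Mapping.lookup m v)"

definition poly_ring :: "nat \<Rightarrow> cpoly set" where
  "poly_ring n = {f. \<forall>m\<in>Poly_Mapping.keys f. Poly_Mapping.keys m \<subseteq> {..<n}}"

text \<open>The graded piece of degree \<open>d\<close>; it contains the zero polynomial.\<close>

definition forms :: "nat \<Rightarrow> nat \<Rightarrow> cpoly set" where
  "forms n d = {f \<in> poly_ring n. \<forall>m\<in>Poly_Mapping.keys f. mono_degree m = d}"

definition cscale :: "complex \<Rightarrow> cpoly \<Rightarrow> cpoly" where
  "cscale c f = Poly_Mapping.single 0 c * f"

global_interpretation cpoly: vector_space cscale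
proof
  show "cscale a (cscale b x) = cscale (a * b) x" for a b x
    by (simp add: cscale_def mult_single flip: mult.assoc)
qed (simp_all add: cscale_def distrib_left distrib_right single_add)

section \<open>Hilbert series and Hilbert generic ideals\<close>

definition gen_ideal :: "nat \<Rightarrow> nat \<Rightarrow> (nat \<Rightarrow> cpoly) \<Rightarrow> cpoly set" where
  "gen_ideal n s h = {\<Sum>i<s. a i * h i | a. \<forall>i<s. a i \<in> poly_ring n}"

text \<open>
  The graded piece of \<open>S/I\<close> in degree \<open>i\<close> is the quotient of the finite-dimensional space
  \<open>forms n i\<close> by its subspace \<open>I \<inter> forms n i\<close>, so its dimension is the difference of the two
  dimensions. Real coefficients are used so that the series can be compared with a quotient
  of power series.
\<close>

definition hilbert_series :: "nat \<Rightarrow> cpoly set \<Rightarrow> real fps" where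
  "hilbert_series n I =
     Abs_fps (\<lambda>i. real (cpoly.dim (forms n i)) - real (cpoly.dim (I \<inter> forms n i)))"

definition truncate_nonpos :: "real fps \<Rightarrow> real fps" where
  "truncate_nonpos a = Abs_fps (\<lambda>i. if \<forall>j\<le>i. fps_nth a j > 0 then fps_nth a i else 0)"

definition hilbert_generic :: "nat \<Rightarrow> nat \<Rightarrow> (nat \<Rightarrow> nat) \<Rightarrow> (nat \<Rightarrow> cpoly) \<Rightarrow> bool" where
  "hilbert_generic n s e h \<longleftrightarrow>
     (\<forall>i<s. h i \<in> forms n (e i)) \<and>
     hilbert_series n (gen_ideal n s h) =
       truncate_nonpos ((\<Prod>i<s. 1 - fps_X ^ e i) / (1 - fps_X) ^ n)"

section \<open>The Zariski topology\<close>

text \<open>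
  \<open>poly_funs X\<close> is the complex algebra of functions generated by a set \<open>X\<close> of coordinate
  functions. On an affine space with coordinates \<open>X\<close> these are exactly the polynomial functions.
\<close>

inductive_set poly_funs :: "('p \<Rightarrow> complex) set \<Rightarrow> ('p \<Rightarrow> complex) set"
  for X :: "('p \<Rightarrow> complex) set" where
  const: "(\<lambda>_. c) \<in> poly_funs X"
| coord: "x \<in> X \<Longrightarrow> x \<in> poly_funs X"
| add: "F \<in> poly_funs X \<Longrightarrow> G \<in> poly_funs X \<Longrightarrow> (\<lambda>p. F p + G p) \<in> poly_funs X"
| mult: "F \<in> poly_funs X \<Longrightarrow> G \<in> poly_funs X \<Longrightarrow> (\<lambda>p. F p * G p) \<in> poly_funs X"

definition zariski_closed :: "'p set \<Rightarrow> ('p \<Rightarrow> complex) set \<Rightarrow> 'p set \<Rightarrow> bool" where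
  "zariski_closed A X Z \<longleftrightarrow> (\<exists>P\<subseteq>poly_funs X. Z = {p\<in>A. \<forall>F\<in>P. F p = 0})"

definition zariski_topology :: "'p set \<Rightarrow> ('p \<Rightarrow> complex) set \<Rightarrow> 'p topology" where
  "zariski_topology A X = topology (\<lambda>U. U \<subseteq> A \<and> zariski_closed A X (A - U))"

lemma zariski_open_iff:
  "U \<subseteq> A \<and> zariski_closed A X (A - U) \<longleftrightarrow>
     (\<exists>P\<subseteq>poly_funs X. U = {p\<in>A. \<exists>F\<in>P. F p \<noteq> 0})" (is "?L \<longleftrightarrow> ?R")
proof
  assume ?L
  then obtain P where "U \<subseteq> A" "P \<subseteq> poly_funs X" "A - U = {p\<in>A. \<forall>F\<in>P. F p = 0}"
    unfolding zariski_closed_def by blast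
  then show ?R by (intro exI[of _ P]) blast
next
  assume ?R
  then obtain P where "P \<subseteq> poly_funs X" "U = {p\<in>A. \<exists>F\<in>P. F p \<noteq> 0}" by blast
  then show ?L unfolding zariski_closed_def by (intro conjI exI[of _ P]) auto
qed

lemma istopology_zariski: "istopology (\<lambda>U. U \<subseteq> A \<and> zariski_closed A X (A - U))"
  unfolding zariski_open_iff istopology_def
proof (intro conjI allI impI)
  fix S T
  assume "\<exists>P\<subseteq>poly_funs X. S = {p\<in>A. \<exists>F\<in>P. F p \<noteq> 0}"
    and "\<exists>P\<subseteq>poly_funs X. T = {p\<in>A. \<exists>F\<in>P. F p \<noteq> 0}"
  then obtain P Q where PQ: "P \<subseteq> poly_funs X" "Q \<subseteq> poly_funs X"
    and S: "S = {p\<in>A. \<exists>F\<in>P. F p \<noteq> 0}" and T: "T = {p\<in>A. \<exists>F\<in>Q. F p \<noteq> 0}"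
    by blast
  let ?R = "(\<lambda>(F, G) p. F p * G p) ` (P \<times> Q)"
  have "?R \<subseteq> poly_funs X" using PQ by (auto intro!: poly_funs.mult)
  moreover have "S \<inter> T = {p\<in>A. \<exists>F\<in>?R. F p \<noteq> 0}" unfolding S T by auto
  ultimately show "\<exists>P\<subseteq>poly_funs X. S \<inter> T = {p\<in>A. \<exists>F\<in>P. F p \<noteq> 0}" by blast
next
  fix K
  assume K: "\<forall>S\<in>K. \<exists>P\<subseteq>poly_funs X. S = {p\<in>A. \<exists>F\<in>P. F p \<noteq> 0}"
  let ?P = "{F\<in>poly_funs X. {p\<in>A. F p \<noteq> 0} \<subseteq> \<Union>K}"
  have "\<Union>K \<subseteq> {p\<in>A. \<exists>F\<in>?P. F p \<noteq> 0}"
  proof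
    fix p
    assume "p \<in> \<Union>K"
    then obtain S where S: "S \<in> K" "p \<in> S" by blast
    with K obtain P where P: "P \<subseteq> poly_funs X" "S = {p\<in>A. \<exists>F\<in>P. F p \<noteq> 0}"
      by (auto dest!: bspec)
    with S obtain F where F: "p \<in> A" "F \<in> P" "F p \<noteq> 0" by auto
    have "{p\<in>A. F p \<noteq> 0} \<subseteq> S" using P(2) F(2) by auto
    then have "F \<in> ?P" using P(1) F(2) S(1) by auto
    then show "p \<in> {p\<in>A. \<exists>F\<in>?P. F p \<noteq> 0}" using F by auto
  qed
  then have "\<Union>K = {p\<in>A. \<exists>F\<in>?P. F p \<noteq> 0}" by (intro equalityI) auto
  then show "\<exists>P\<subseteq>poly_funs X. \<Union>K = {p\<in>A. \<exists>F\<in>P. F p \<noteq> 0}"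
    by (intro exI[of _ ?P] conjI) auto
qed

lemma openin_zariski:
  "openin (zariski_topology A X) U \<longleftrightarrow> U \<subseteq> A \<and> zariski_closed A X (A - U)"
  unfolding zariski_topology_def by (simp add: istopology_zariski)

lemma topspace_zariski: "topspace (zariski_topology A X) = A"
proof
  show "topspace (zariski_topology A X) \<subseteq> A"
    unfolding topspace_def openin_zariski by blast
  have "zariski_closed A X (A - A)"
    unfolding zariski_closed_def
    by (intro exI[of _ "{\<lambda>_. 1}"]) (auto intro: poly_funs.const)
  then show "A \<subseteq> topspace (zariski_topology A X)"
    using openin_subset[of "zariski_topology A X" A] openin_zariski[of A X A] by blast
qed

text \<open>The coordinates of a form, or of a tuple of forms, are its coefficients.\<close>

definition forms_topology :: "nat \<Rightarrow> nat \<Rightarrow> cpoly topology" where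
  "forms_topology n d =
     zariski_topology (forms n d) {(\<lambda>f. Poly_Mapping.lookup f m) | m. True}"

definition form_tuples :: "nat \<Rightarrow> nat \<Rightarrow> nat \<Rightarrow> (nat \<Rightarrow> cpoly) set" where
  "form_tuples n d s = {..<s} \<rightarrow>\<^sub>E forms n d"

definition form_tuples_topology :: "nat \<Rightarrow> nat \<Rightarrow> nat \<Rightarrow> (nat \<Rightarrow> cpoly) topology" where
  "form_tuples_topology n d s =
     zariski_topology (form_tuples n d s) {(\<lambda>g. Poly_Mapping.lookup (g i) m) | i m. i < s}"

definition for_generic_forms ::
    "nat \<Rightarrow> nat \<Rightarrow> nat \<Rightarrow> ((nat \<Rightarrow> cpoly) \<Rightarrow> bool) \<Rightarrow> bool" where
  "for_generic_forms n d s Q \<longleftrightarrow>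
     (\<exists>U. openin (form_tuples_topology n d s) U \<and> U \<noteq> {} \<and> (\<forall>g\<in>U. Q g))"

section \<open>Generic rank\<close>

definition power_sums :: "nat \<Rightarrow> nat \<Rightarrow> nat \<Rightarrow> nat \<Rightarrow> cpoly set" where
  "power_sums k n d s = {\<Sum>i<s. g i ^ k | g. g \<in> form_tuples n d s}"

text \<open>
  The generic \<open>k\<close>-rank of forms of degree \<open>k * d\<close> in \<open>n\<close> variables: the least \<open>s\<close> such that the
  sums of \<open>s\<close> many \<open>k\<close>-th powers of forms of degree \<open>d\<close> are Zariski dense.
\<close>

definition generic_rank :: "nat \<Rightarrow> nat \<Rightarrow> nat \<Rightarrow> nat" where
  "generic_rank k n d =
     (LEAST s. (forms_topology n (k * d)) closure_of (power_sums k n d s) = forms n (k * d))"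

end

theory Submission
  imports Defs "HOL-Library.Function_Algebras" "HOL-Computational_Algebra.Polynomial"
begin

text \<open>
  The differential of the map \<open>(g\<^sub>1, \<dots>, g\<^sub>s) \<mapsto> g\<^sub>1\<^sup>k + \<dots> + g\<^sub>s\<^sup>k\<close> at a tuple \<open>g\<close> sends \<open>h\<close> to
  \<open>k (g\<^sub>1\<^sup>k\<^sup>-\<^sup>1 h\<^sub>1 + \<dots> + g\<^sub>s\<^sup>k\<^sup>-\<^sup>1 h\<^sub>s)\<close>, so its image is the part of degree \<open>k * d\<close> of the ideal
  generated by the forms \<open>g\<^sub>i\<^sup>k\<^sup>-\<^sup>1\<close>. If that ideal is Hilbert generic for generic \<open>g\<close>, the image is
  everything as soon as the coefficient of degree \<open>k * d\<close> in \<open>(1 - t\<^sup>e)\<^sup>s / (1 - t)\<^sup>n\<close>, where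
  \<open>e = d (k - 1)\<close>, is not positive. With \<open>N\<^sub>j\<close> the number of monomials of degree \<open>j\<close>, this
  coefficient is \<open>N\<^bsub>kd\<^esub> - s N\<^sub>d\<close> for \<open>k \<ge> 3\<close>, since then \<open>kd = e + d < 2e\<close>, and
  \<open>N\<^bsub>2d\<^esub> - s N\<^sub>d + (s choose 2)\<close> for \<open>k = 2\<close>, since then \<open>kd = 2e\<close>. Its being non-positive is
  exactly the inequality in the conclusion.

  A surjective differential on a nonempty Zariski open set of tuples makes the image dense. For
  let \<open>F\<close> be a polynomial vanishing on the image of that set. By the chain rule every directional
  derivative of \<open>F\<close> vanishes there too; hence so do all iterated ones, the Taylor expansion of \<open>F\<close>
  at a single point of the image is zero, and \<open>F = 0\<close> (\<open>vanishes_if_tangent_surjective\<close>). This is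
  where the hypothesis on Hilbert generic ideals gives the upper bound for the rank.

  The lower bound is a dimension count. Polynomials of bounded degree in \<open>N\<close> unknowns form a space
  of larger dimension than those in \<open>M < N\<close> unknowns, even when the degree in the latter is
  bounded by a fixed multiple; hence a family of forms depending polynomially on fewer
  parameters than there are coefficients lies in a hypersurface (\<open>algebraic_relation\<close>). For
  \<open>k \<ge> 3\<close> the parameters are the \<open>s N\<^sub>d\<close> coefficients of the \<open>g\<^sub>i\<close>. For \<open>k = 2\<close> this is too many,
  because orthogonal substitutions do not change a sum of squares. There the sum is regarded as a
  quadratic expression in a basis of an \<open>s\<close>-dimensional space containing the \<open>g\<^sub>i\<close>: such a subspace
  of the forms of degree \<open>d\<close>, with a reduced echelon basis, is given by a set of pivot monomials and
  \<open>s (N\<^sub>d - s)\<close> numbers, and the quadratic expression by \<open>s (s + 1) / 2\<close> more, which makes \<open>s N\<^sub>d - (s choose 2)\<close> in total. The finitely many choices of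
  pivots are combined by multiplying the equations (\<open>square_sums_not_dense\<close>). Only values
  \<open>s \<le> N\<^sub>d\<close> have to be considered, because \<open>N\<^bsub>2d\<^esub> \<le> N\<^sub>d (N\<^sub>d + 1) / 2\<close>: every monomial of degree
  \<open>2d\<close> is a product of two of degree \<open>d\<close>.
\<close>

section \<open>Monomials and forms\<close>

definition monoms :: "nat \<Rightarrow> nat \<Rightarrow> (nat \<Rightarrow>\<^sub>0 nat) set" where
  "monoms n d = {m. Poly_Mapping.keys m \<subseteq> {..<n} \<and> mono_degree m = d}"

lemma mono_degree_eq_sum:
  assumes "finite A" "Poly_Mapping.keys m \<subseteq> A"
  shows "mono_degree m = (\<Sum>v\<in>A. Poly_Mapping.lookup m v)"
  unfolding mono_degree_def using assms
  by (intro sum.mono_neutral_left) (auto simp: in_keys_iff)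

lemma mono_degree_add: "mono_degree (a + b) = mono_degree a + mono_degree b"
proof -
  let ?A = "Poly_Mapping.keys a \<union> Poly_Mapping.keys b"
  have "mono_degree x = (\<Sum>v\<in>?A. Poly_Mapping.lookup x v)" if "x \<in> {a, b, a + b}" for x
    using that keys_add[of a b] by (intro mono_degree_eq_sum) auto
  then show ?thesis by (simp add: lookup_add sum.distrib)
qed

lemma mono_degree_single: "mono_degree (Poly_Mapping.single v k) = k"
  by (cases "k = 0") (auto simp: mono_degree_def)

lemma monoms_add: "a \<in> monoms n d \<Longrightarrow> b \<in> monoms n e \<Longrightarrow> a + b \<in> monoms n (d + e)"
  using keys_add[of a b] by (auto simp: monoms_def mono_degree_add)

lemma bij_betw_monoms_lists:
  "bij_betw (\<lambda>m. map (Poly_Mapping.lookup m) [0..<n]) (monoms n d)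
     {l. length l = n \<and> sum_list l = d}"
proof (rule bij_betwI[where g = Poly_Mapping.nth])
  show "(\<lambda>m. map (Poly_Mapping.lookup m) [0..<n])
      \<in> monoms n d \<rightarrow> {l. length l = n \<and> sum_list l = d}"
    by (auto simp: monoms_def mono_degree_eq_sum[of "{..<n}"] sum_list_distinct_conv_sum_set
        atLeast0LessThan)
  have keys: "Poly_Mapping.keys (Poly_Mapping.nth l) \<subseteq> {..<length l}" for l :: "nat list"
    by (auto simp: in_keys_iff nth_default_def simp del: keys_nth split: if_splits)
  show "Poly_Mapping.nth \<in> {l. length l = n \<and> sum_list l = d} \<rightarrow> monoms n d"
    using keys by (auto simp: monoms_def mono_degree_eq_sum[OF _ keys] sum_list_sum_nth
        nth_default_def atLeast0LessThan simp del: keys_nth)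
  show "Poly_Mapping.nth (map (Poly_Mapping.lookup x) [0..<n]) = x" if "x \<in> monoms n d" for x
    using that by (intro poly_mapping_eqI)
      (auto simp: monoms_def nth_default_def in_keys_iff subset_iff)
  show "map (Poly_Mapping.lookup (Poly_Mapping.nth y)) [0..<n] = y"
    if "y \<in> {l. length l = n \<and> sum_list l = d}" for y
    using that by (auto intro!: nth_equalityI simp: nth_default_def)
qed

lemma finite_monoms [simp]: "finite (monoms n d)"
proof -
  have "{l. length l = n \<and> sum_list l = d} \<subseteq> {l. set l \<subseteq> {..d} \<and> length l = n}"
    by (auto dest: member_le_sum_list)
  then have "finite {l :: nat list. length l = n \<and> sum_list l = d}"
    by (rule finite_subset) (simp add: finite_lists_length_eq)
  then show ?thesis using bij_betw_finite[OF bij_betw_monoms_lists] by blast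
qed

lemma card_monoms:
  assumes "n \<ge> 1"
  shows "card (monoms n d) = (d + n - 1) choose (n - 1)"
proof -
  have "card (monoms n d) = (d + n - 1) choose d"
    using bij_betw_same_card[OF bij_betw_monoms_lists] by (simp add: card_length_sum_list)
  also have "\<dots> = (d + n - 1) choose (n - 1)"
    using assms binomial_symmetric[of d "d + n - 1"] by simp
  finally show ?thesis .
qed

lemma monoms_split:
  "m \<in> monoms n (a + b) \<Longrightarrow> \<exists>p\<in>monoms n a. \<exists>q\<in>monoms n b. m = p + q"
proof (induction a arbitrary: m)
  case 0
  then show ?case by (intro bexI[of _ 0] bexI[of _ m]) (auto simp: monoms_def mono_degree_def)
next
  case (Suc a)
  then have "m \<noteq> 0" by (auto simp: monoms_def mono_degree_def)
  then obtain v where v: "v \<in> Poly_Mapping.keys m"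
    by (metis ex_in_conv keys_zero lookup_zero not_in_keys_iff_lookup_eq_zero poly_mapping_eqI)
  let ?x = "Poly_Mapping.single v (1::nat)"
  have vn: "v < n" using v Suc.prems by (auto simp: monoms_def)
  have m: "m = ?x + (m - ?x)"
    using v by (intro poly_mapping_eqI)
      (auto simp: lookup_add lookup_minus lookup_single when_def in_keys_iff)
  have "Suc (a + b) = 1 + mono_degree (m - ?x)"
    using Suc.prems mono_degree_add[of ?x "m - ?x"] m
    by (simp add: monoms_def mono_degree_single)
  moreover have "Poly_Mapping.keys (m - ?x) \<subseteq> Poly_Mapping.keys m"
    by (auto simp: in_keys_iff lookup_minus)
  ultimately have "m - ?x \<in> monoms n (a + b)" using Suc.prems by (auto simp: monoms_def)
  then obtain p q where pq: "p \<in> monoms n a" "q \<in> monoms n b" "m - ?x = p + q"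
    using Suc.IH by blast
  have "?x + p \<in> monoms n (Suc a)"
    using monoms_add[of ?x n 1 p a] pq(1) vn by (auto simp: monoms_def mono_degree_single)
  then show ?case using pq m by (metis add.assoc)
qed

lemma forms_iff: "f \<in> forms n d \<longleftrightarrow> Poly_Mapping.keys f \<subseteq> monoms n d"
  by (auto simp: forms_def poly_ring_def monoms_def)

lemma lookup_cscale [simp]: "Poly_Mapping.lookup (cscale c f) m = c * Poly_Mapping.lookup f m"
proof -
  have "Poly_Mapping.map ((*) c) f = cscale c f"
    unfolding cscale_def by (rule mult_map_scale_conv_mult)
  then have "Poly_Mapping.lookup (cscale c f) m = Poly_Mapping.lookup (Poly_Mapping.map ((*) c) f) m"
    by (simp only:)
  then show ?thesis by (simp add: Poly_Mapping.map.rep_eq when_def)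
qed

lemma cscale_mult_left: "cscale c f * g = cscale c (f * g)"
  by (simp add: cscale_def mult.assoc)

lemma cscale_mult_right: "f * cscale c g = cscale c (f * g)"
  by (simp add: cscale_def mult.left_commute)

lemma subspace_forms: "cpoly.subspace (forms n d)"
proof (rule cpoly.subspaceI)
  show "x + y \<in> forms n d" if "x \<in> forms n d" "y \<in> forms n d" for x y
    using that keys_add[of x y] by (auto simp: forms_iff)
qed (auto simp: forms_iff in_keys_iff)

lemma forms_mult: "f \<in> forms n d \<Longrightarrow> g \<in> forms n e \<Longrightarrow> f * g \<in> forms n (d + e)"
  using keys_mult[of f g] monoms_add unfolding forms_iff by blast

lemma forms_power: "f \<in> forms n d \<Longrightarrow> f ^ k \<in> forms n (k * d)"
proof (induction k)
  case 0
  then show ?case by (simp add: forms_iff monoms_def mono_degree_def)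
next
  case (Suc k)
  then show ?case using forms_mult[of f n d "f ^ k" "k * d"] by simp
qed

lemma single_in_forms: "m \<in> monoms n d \<Longrightarrow> Poly_Mapping.single m c \<in> forms n d"
  by (auto simp: forms_iff)

lemma cscale_single: "cscale c (Poly_Mapping.single m x) = Poly_Mapping.single m (c * x)"
  by (simp add: cscale_def mult_single)

lemma lookup_sum_single:
  assumes "finite A"
  shows "Poly_Mapping.lookup (\<Sum>m\<in>A. Poly_Mapping.single m (y m)) k = (if k \<in> A then y k else 0)"
  using assms by (simp add: lookup_sum lookup_single when_def)

lemma form_eq_sum:
  assumes "f \<in> forms n d"
  shows "f = (\<Sum>m\<in>monoms n d. Poly_Mapping.single m (Poly_Mapping.lookup f m))"
  using assms
  by (intro poly_mapping_eqI) (auto simp: lookup_sum_single forms_iff in_keys_iff subset_iff)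

lemma forms_subset_span:
  "forms n d \<subseteq> cpoly.span ((\<lambda>m. Poly_Mapping.single m 1) ` monoms n d)"
proof
  fix f assume "f \<in> forms n d"
  from form_eq_sum[OF this]
  have "f = (\<Sum>m\<in>monoms n d. cscale (Poly_Mapping.lookup f m) (Poly_Mapping.single m 1))"
    by (simp add: cscale_single)
  also have "\<dots> \<in> cpoly.span ((\<lambda>m. Poly_Mapping.single m 1) ` monoms n d)"
    by (intro cpoly.span_sum cpoly.span_scale cpoly.span_base) auto
  finally show "f \<in> \<dots>" .
qed

lemma lookup_mult_forms:
  assumes "f \<in> forms n d" "g \<in> forms n e"
  shows "Poly_Mapping.lookup (f * g) k =
    (\<Sum>a\<in>monoms n d. \<Sum>b\<in>monoms n e. 
       if k = a + b then Poly_Mapping.lookup f a * Poly_Mapping.lookup g b else 0)"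
proof -
  have "f * g = (\<Sum>a\<in>monoms n d. \<Sum>b\<in>monoms n e.
      Poly_Mapping.single (a + b) (Poly_Mapping.lookup f a * Poly_Mapping.lookup g b))"
    by (subst form_eq_sum[OF assms(1)], subst form_eq_sum[OF assms(2)])
       (simp add: sum_product mult_single)
  then show ?thesis by (auto simp: lookup_sum lookup_single when_def intro!: sum.cong)
qed

definition hom_comp :: "nat \<Rightarrow> cpoly \<Rightarrow> cpoly" where
  "hom_comp d f = (\<Sum>m\<in>{m \<in> Poly_Mapping.keys f. mono_degree m = d}.
      Poly_Mapping.single m (Poly_Mapping.lookup f m))"

lemma lookup_hom_comp:
  "Poly_Mapping.lookup (hom_comp d f) m = (if mono_degree m = d then Poly_Mapping.lookup f m else 0)"
  by (auto simp: hom_comp_def lookup_sum_single in_keys_iff)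

lemma hom_comp_in_forms: "f \<in> poly_ring n \<Longrightarrow> hom_comp d f \<in> forms n d"
  by (auto simp: forms_def poly_ring_def in_keys_iff lookup_hom_comp split: if_splits)

lemma hom_comp_sum: "hom_comp d (\<Sum>i\<in>A. f i) = (\<Sum>i\<in>A. hom_comp d (f i))"
  by (intro poly_mapping_eqI) (simp add: lookup_hom_comp lookup_sum)

lemma hom_comp_form: "f \<in> forms n d \<Longrightarrow> hom_comp d f = f"
  by (intro poly_mapping_eqI) (auto simp: lookup_hom_comp forms_def in_keys_iff)

text \<open>
  Multiplication by a form shifts degrees, so the coefficients that express a form as an element of
  a homogeneous ideal may be replaced by their homogeneous components.
\<close>

lemma hom_comp_mult_form:
  assumes "g \<in> forms n e"
  shows "hom_comp (d + e) (f * g) = hom_comp d f * g"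
proof -
  define r where "r = f - hom_comp d f"
  have r: "mono_degree m \<noteq> d" if "m \<in> Poly_Mapping.keys r" for m
    using that by (auto simp: r_def in_keys_iff lookup_minus lookup_hom_comp)
  have h: "mono_degree m = d" if "m \<in> Poly_Mapping.keys (hom_comp d f)" for m
    using that by (auto simp: in_keys_iff lookup_hom_comp split: if_splits)
  have g: "mono_degree m = e" if "m \<in> Poly_Mapping.keys g" for m
    using that assms by (auto simp: forms_def)
  have "f * g = hom_comp d f * g + r * g" by (simp add: r_def algebra_simps)
  moreover have "Poly_Mapping.lookup (r * g) m = 0" if "mono_degree m = d + e" for m
    using keys_mult[of r g] that r g
    by (auto simp: not_in_keys_iff_lookup_eq_zero[symmetric] mono_degree_add dest!: subsetD)
  moreover have "Poly_Mapping.lookup (hom_comp d f * g) m = 0" if "mono_degree m \<noteq> d + e" for m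
    using keys_mult[of "hom_comp d f" g] that h g
    by (auto simp: not_in_keys_iff_lookup_eq_zero[symmetric] mono_degree_add dest!: subsetD)
  ultimately show ?thesis
    by (intro poly_mapping_eqI) (auto simp: lookup_hom_comp lookup_add)
qed

section \<open>Polynomial functions and Zariski density\<close>

lemma poly_funs_sum:
  "finite A \<Longrightarrow> (\<And>a. a \<in> A \<Longrightarrow> F a \<in> poly_funs X) \<Longrightarrow> (\<lambda>p. \<Sum>a\<in>A. F a p) \<in> poly_funs X"
  by (induction A rule: finite_induct) (auto intro: poly_funs.add poly_funs.const)

lemma poly_funs_prod:
  "finite A \<Longrightarrow> (\<And>a. a \<in> A \<Longrightarrow> F a \<in> poly_funs X) \<Longrightarrow> (\<lambda>p. \<Prod>a\<in>A. F a p) \<in> poly_funs X"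
  by (induction A rule: finite_induct) (auto intro: poly_funs.mult poly_funs.const)

lemma poly_funs_power: "F \<in> poly_funs X \<Longrightarrow> (\<lambda>p. F p ^ k) \<in> poly_funs X"
  using poly_funs_prod[of "{..<k}" "\<lambda>_. F"] by simp

lemma poly_funs_comp:
  assumes "F \<in> poly_funs X" "\<And>x. x \<in> X \<Longrightarrow> (\<lambda>q. x (h q)) \<in> poly_funs Y"
  shows "(\<lambda>q. F (h q)) \<in> poly_funs Y"
  using assms by induction (auto intro: poly_funs.intros)

text \<open>
  Used for lines, where each coordinate is affine in the parameter: it turns questions about a
  polynomial function into questions about a polynomial in one variable.
\<close>

lemma poly_funs_along_curve:
  assumes "F \<in> poly_funs X" "\<And>x. x \<in> X \<Longrightarrow> \<exists>P. \<forall>t. x (c t) = poly P t"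
  shows "\<exists>P. \<forall>t. F (c t) = poly P t"
  using assms
proof induction
  case (const a)
  show ?case by (intro exI[of _ "[:a:]"]) simp
next
  case (add F G)
  then obtain P Q where "\<forall>t. F (c t) = poly P t" "\<forall>t. G (c t) = poly Q t" by blast
  then show ?case by (intro exI[of _ "P + Q"]) simp
next
  case (mult F G)
  then obtain P Q where "\<forall>t. F (c t) = poly P t" "\<forall>t. G (c t) = poly Q t" by blast
  then show ?case by (intro exI[of _ "P * Q"]) simp
qed

text \<open>
  The prescribed velocities \<open>\<delta> x\<close> of the coordinates are constants, so the derivative of \<open>F\<close> along
  any curve with these velocities depends on the position only, and polynomially. One function \<open>F'\<close>
  thus serves as the derivative along all curves with the same tangent direction, which is the
  chain rule in the form needed below.
\<close>

lemma poly_funs_derivative: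
  assumes "F \<in> poly_funs X"
  shows "\<exists>F'\<in>poly_funs X. \<forall>c t.
    (\<forall>x\<in>X. ((\<lambda>u. x (c u)) has_field_derivative \<delta> x) (at t)) \<longrightarrow>
    ((\<lambda>u. F (c u)) has_field_derivative F' (c t)) (at t)"
  using assms
proof induction
  case (const a)
  show ?case by (intro bexI[of _ "\<lambda>_. 0"] poly_funs.const) auto
next
  case (coord x)
  then show ?case by (intro bexI[of _ "\<lambda>_. \<delta> x"] poly_funs.const) auto
next
  case (add F G)
  then obtain F' G' where "F' \<in> poly_funs X" "G' \<in> poly_funs X"
    "\<And>c t. (\<forall>x\<in>X. ((\<lambda>u. x (c u)) has_field_derivative \<delta> x) (at t)) \<Longrightarrow>
      ((\<lambda>u. F (c u)) has_field_derivative F' (c t)) (at t)"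
    "\<And>c t. (\<forall>x\<in>X. ((\<lambda>u. x (c u)) has_field_derivative \<delta> x) (at t)) \<Longrightarrow>
      ((\<lambda>u. G (c u)) has_field_derivative G' (c t)) (at t)"
    by blast
  then show ?case
    by (intro bexI[of _ "\<lambda>p. F' p + G' p"]) (auto intro!: DERIV_add poly_funs.add)
next
  case (mult F G)
  then obtain F' G' where *: "F' \<in> poly_funs X" "G' \<in> poly_funs X"
    "\<And>c t. (\<forall>x\<in>X. ((\<lambda>u. x (c u)) has_field_derivative \<delta> x) (at t)) \<Longrightarrow>
      ((\<lambda>u. F (c u)) has_field_derivative F' (c t)) (at t)"
    "\<And>c t. (\<forall>x\<in>X. ((\<lambda>u. x (c u)) has_field_derivative \<delta> x) (at t)) \<Longrightarrow>
      ((\<lambda>u. G (c u)) has_field_derivative G' (c t)) (at t)"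
    by blast
  show ?case
  proof (intro bexI[of _ "\<lambda>p. F' p * G p + G' p * F p"] allI impI)
    show "(\<lambda>p. F' p * G p + G' p * F p) \<in> poly_funs X"
      using * mult by (intro poly_funs.add poly_funs.mult)
  qed (auto intro!: DERIV_mult *(3,4))
qed

abbreviation coeff_funs :: "(cpoly \<Rightarrow> complex) set" where
  "coeff_funs \<equiv> {(\<lambda>f. Poly_Mapping.lookup f m) | m. True}"

text \<open>
  The principal open sets \<open>F \<noteq> 0\<close> form a basis, so a set is dense when it meets each nonempty one.
\<close>

lemma closure_of_eq_forms_iff:
  assumes "S \<subseteq> forms n d"
  shows "(forms_topology n d) closure_of S = forms n d \<longleftrightarrow>
    (\<forall>F\<in>poly_funs coeff_funs. (\<forall>f\<in>S. F f = 0) \<longrightarrow> (\<forall>f\<in>forms n d. F f = 0))"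
proof -
  have open_iff: "openin (forms_topology n d) T \<longleftrightarrow>
      (\<exists>P\<subseteq>poly_funs coeff_funs. T = {p\<in>forms n d. \<exists>F\<in>P. F p \<noteq> 0})" for T
    unfolding forms_topology_def openin_zariski zariski_open_iff ..
  have "(forms_topology n d) closure_of S = forms n d \<longleftrightarrow>
      (\<forall>T. openin (forms_topology n d) T \<and> T \<noteq> {} \<longrightarrow> S \<inter> T \<noteq> {})"
    using dense_intersects_open[of "forms_topology n d" S]
    by (simp add: forms_topology_def topspace_zariski)
  also have "\<dots> \<longleftrightarrow>
      (\<forall>F\<in>poly_funs coeff_funs. (\<forall>f\<in>S. F f = 0) \<longrightarrow> (\<forall>f\<in>forms n d. F f = 0))"
  proof safe
    fix F f
    assume dense: "\<forall>T. openin (forms_topology n d) T \<and> T \<noteq> {} \<longrightarrow> S \<inter> T \<noteq> {}"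
      and F: "F \<in> poly_funs coeff_funs" "\<forall>f\<in>S. F f = 0" and f: "f \<in> forms n d"
    show "F f = 0"
    proof (rule ccontr)
      assume "F f \<noteq> 0"
      let ?T = "{p\<in>forms n d. F p \<noteq> 0}"
      have "openin (forms_topology n d) ?T"
        unfolding open_iff using F by (intro exI[of _ "{F}"]) auto
      with dense f \<open>F f \<noteq> 0\<close> have "S \<inter> ?T \<noteq> {}" by blast
      with F show False by auto
    qed
  next
    fix T f
    assume van: "\<forall>F\<in>poly_funs coeff_funs. (\<forall>f\<in>S. F f = 0) \<longrightarrow> (\<forall>f\<in>forms n d. F f = 0)"
      and T: "openin (forms_topology n d) T" and f: "f \<in> T" and empty: "S \<inter> T = {}"
    from T f obtain P F where P: "P \<subseteq> poly_funs coeff_funs"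
        "T = {p\<in>forms n d. \<exists>F\<in>P. F p \<noteq> 0}" and F: "F \<in> P" "F f \<noteq> 0"
      unfolding open_iff by blast
    from F P f van obtain g where "g \<in> S" "F g \<noteq> 0" by blast
    with P F assms have "g \<in> S \<inter> T" by blast
    with empty show "f \<in> {}" by simp
  qed
  finally show ?thesis .
qed

section \<open>Density from a surjective differential\<close>

text \<open>
  The ambient space is infinite-dimensional; finiteness comes from the spanning set \<open>B\<close>.
\<close>

lemma (in vector_space) subset_of_dim_eq:
  assumes "subspace W" "W \<subseteq> V" "V \<subseteq> span B" "finite B" "dim W = dim V"
  shows "V \<subseteq> W"
proof -
  obtain A where A: "A \<subseteq> W" "independent A" "W \<subseteq> span A" "card A = dim W"
    by (rule basis_exists)
  then obtain A' where A': "A \<subseteq> A'" "A' \<subseteq> V" "independent A'" "V \<subseteq> span A'"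
    by (metis maximal_independent_subset_extend assms(2) subset_trans)
  have "finite A'" using independent_span_bound[of B A'] A' assms by blast
  moreover have "card A = card A'" using basis_card_eq_dim[of A' V] A A' assms(5) by simp
  ultimately have "A = A'" using A' by (intro card_subset_eq)
  then show ?thesis using A'(4) A(1) assms(1) span_minimal by blast
qed

lemma cscale_power: "cscale t h ^ j = cscale (t ^ j) (h ^ j)"
proof -
  have "Poly_Mapping.single 0 t ^ j = (Poly_Mapping.single 0 (t ^ j) :: cpoly)"
    by (induction j) (auto simp: mult_single single_one)
  then show ?thesis by (simp add: cscale_def power_mult_distrib)
qed

lemma lookup_power_expansion:
  "Poly_Mapping.lookup ((f + cscale t h) ^ k) m =
    (\<Sum>j\<le>k. Poly_Mapping.lookup (of_nat (k choose j) * h ^ j * f ^ (k - j)) m * t ^ j)"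
proof -
  have "(f + cscale t h) ^ k = (cscale t h + f) ^ k" by (simp add: add.commute)
  also have "\<dots> = (\<Sum>j\<le>k. cscale (t ^ j) (of_nat (k choose j) * h ^ j * f ^ (k - j)))"
    unfolding binomial_ring by (simp add: cscale_power cscale_mult_left cscale_mult_right)
  finally show ?thesis by (simp add: lookup_sum mult.commute)
qed

lemma lookup_power_curve_derivative:
  assumes "k \<ge> 1"
  shows "((\<lambda>t. Poly_Mapping.lookup ((f + cscale t h) ^ k) m) has_field_derivative
    Poly_Mapping.lookup (of_nat k * f ^ (k - 1) * h) m) (at 0)"
proof -
  define a where "a j = Poly_Mapping.lookup (of_nat (k choose j) * h ^ j * f ^ (k - j)) m" for j
  have "((\<lambda>t. \<Sum>j\<le>k. a j * t ^ j) has_field_derivative (\<Sum>j\<le>k. a j * (of_nat j * 0 ^ (j - 1)))) (at 0)"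
    by (auto intro!: derivative_eq_intros simp: mult_ac)
  moreover have "(\<Sum>j\<le>k. a j * (of_nat j * 0 ^ (j - 1))) = (\<Sum>j\<in>{1}. a j * (of_nat j * 0 ^ (j - 1)))"
    using assms by (intro sum.mono_neutral_right) (auto simp: power_0_left)
  moreover have "a 1 = Poly_Mapping.lookup (of_nat k * f ^ (k - 1) * h) m"
    by (simp add: a_def mult_ac)
  ultimately show ?thesis by (simp add: lookup_power_expansion a_def[symmetric])
qed

abbreviation tuple_coeff_funs :: "nat \<Rightarrow> ((nat \<Rightarrow> cpoly) \<Rightarrow> complex) set" where
  "tuple_coeff_funs s \<equiv> {(\<lambda>g. Poly_Mapping.lookup (g i) m) | i m. i < s}"

lemma form_tuples_line:
  assumes "g \<in> form_tuples n d s" "\<And>i. i < s \<Longrightarrow> h i \<in> forms n d"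
  shows "(\<lambda>i\<in>{..<s}. g i + cscale t (h i)) \<in> form_tuples n d s"
  using assms subspace_forms[of n d]
  by (auto simp: form_tuples_def PiE_iff cpoly.subspace_add cpoly.subspace_scale)

text \<open>
  Along the curve obtained by moving \<open>g\<close> in direction \<open>h\<close>, the point stays in the open set \<open>G \<noteq> 0\<close> for
  small times, so \<open>F\<close> is constantly zero near time 0. The velocity at time 0 is \<open>q\<close>.
\<close>

lemma vanishing_tangent_derivative:
  assumes k: "k \<ge> 1" and G: "G \<in> poly_funs (tuple_coeff_funs s)"
    and F: "F \<in> poly_funs coeff_funs"
    and vanish: "\<And>g. g \<in> form_tuples n d s \<Longrightarrow> G g \<noteq> 0 \<Longrightarrow> F (\<Sum>i<s. g i ^ k) = 0"
    and F': "\<And>c t. (\<And>m. ((\<lambda>u. Poly_Mapping.lookup (c u) m) has_field_derivative Poly_Mapping.lookup q m) (at t)) \<Longrightarrow>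
        ((\<lambda>u. F (c u)) has_field_derivative F' (c t)) (at t)"
    and g: "g \<in> form_tuples n d s" "G g \<noteq> 0"
    and h: "\<And>i. i < s \<Longrightarrow> h i \<in> forms n d"
    and q: "q = (\<Sum>i<s. of_nat k * g i ^ (k - 1) * h i)"
  shows "F' (\<Sum>i<s. g i ^ k) = 0"
proof -
  define \<gamma> where "\<gamma> t = (\<lambda>i\<in>{..<s}. g i + cscale t (h i))" for t
  define c where "c t = (\<Sum>i<s. \<gamma> t i ^ k)" for t
  have c0: "c 0 = (\<Sum>i<s. g i ^ k)" by (simp add: c_def \<gamma>_def)
  have "((\<lambda>u. Poly_Mapping.lookup (c u) m) has_field_derivative Poly_Mapping.lookup q m) (at 0)" for m
    unfolding c_def \<gamma>_def q lookup_sum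
    using lookup_power_curve_derivative[OF k] by (auto intro!: DERIV_sum)
  from F'[OF this] have 1: "((\<lambda>u. F (c u)) has_field_derivative F' (c 0)) (at 0)" .
  have "\<exists>P. \<forall>t. G (\<gamma> t) = poly P t"
  proof (rule poly_funs_along_curve[OF G])
    fix x assume "x \<in> tuple_coeff_funs s"
    then obtain i m where x: "x = (\<lambda>g. Poly_Mapping.lookup (g i) m)" "i < s" by blast
    then show "\<exists>P. \<forall>t. x (\<gamma> t) = poly P t"
      by (intro exI[of _ "[:Poly_Mapping.lookup (g i) m, Poly_Mapping.lookup (h i) m:]"])
         (simp add: \<gamma>_def lookup_add)
  qed
  then obtain P where P: "G (\<gamma> t) = poly P t" for t by blast
  have "\<gamma> 0 = g" using g(1) by (auto simp: \<gamma>_def form_tuples_def PiE_iff extensional_def)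
  then have "poly P 0 \<noteq> 0" using g(2) P[of 0] by simp
  moreover have "isCont (poly P) 0" by (rule poly_isCont)
  ultimately have "\<forall>\<^sub>F t in nhds 0. poly P t \<noteq> 0"
    unfolding continuous_at tendsto_at_iff_tendsto_nhds by (blast intro: tendsto_imp_eventually_ne)
  then have "\<forall>\<^sub>F t in nhds 0. F (c t) = 0"
  proof eventually_elim
    case (elim t)
    then show ?case
      using vanish[of "\<gamma> t"] P form_tuples_line[OF g(1) h] unfolding c_def \<gamma>_def by auto
  qed
  then have "((\<lambda>u. F (c u)) has_field_derivative 0) (at 0)"
    using DERIV_cong_ev[of 0 0 "\<lambda>u. F (c u)" "\<lambda>_. 0" 0 0] by simp
  with 1 have "F' (c 0) = 0" by (rule DERIV_unique)
  then show ?thesis by (simp add: c0)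
qed

text \<open>
  The functions vanishing on the image of \<open>G \<noteq> 0\<close> are closed under derivatives in all directions, so
  all derivatives of \<open>F\<close> at the image of \<open>g0\<close> in the direction of \<open>f\<close> are zero. On the line
  through these two points \<open>F\<close> is a polynomial in one variable, and it has no nonzero coefficient.
\<close>

lemma vanishes_if_tangent_surjective:
  assumes k: "k \<ge> 1" and G: "G \<in> poly_funs (tuple_coeff_funs s)"
    and g0: "g0 \<in> form_tuples n d s" "G g0 \<noteq> 0"
    and surj: "\<And>g q. g \<in> form_tuples n d s \<Longrightarrow> G g \<noteq> 0 \<Longrightarrow> q \<in> forms n (k * d) \<Longrightarrow>
      \<exists>h. (\<forall>i<s. h i \<in> forms n d) \<and> q = (\<Sum>i<s. of_nat k * g i ^ (k - 1) * h i)"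
    and F: "F \<in> poly_funs coeff_funs" "\<And>f. f \<in> power_sums k n d s \<Longrightarrow> F f = 0"
    and f: "f \<in> forms n (k * d)"
  shows "F f = 0"
proof -
  define p0 where "p0 = (\<Sum>i<s. g0 i ^ k)"
  define q where "q = f - p0"
  have "p0 \<in> forms n (k * d)"
    unfolding p0_def using g0
    by (intro cpoly.subspace_sum[OF subspace_forms] forms_power) (auto simp: form_tuples_def)
  then have q: "q \<in> forms n (k * d)"
    using f cpoly.subspace_diff[OF subspace_forms] unfolding q_def by blast
  define V where "V = {F \<in> poly_funs coeff_funs.
      \<forall>g\<in>form_tuples n d s. G g \<noteq> 0 \<longrightarrow> F (\<Sum>i<s. g i ^ k) = 0}"
  define is_deriv where "is_deriv F F' \<longleftrightarrow> (\<forall>c t.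
      (\<forall>m. ((\<lambda>u. Poly_Mapping.lookup (c u) m) has_field_derivative Poly_Mapping.lookup q m) (at t)) \<longrightarrow>
      ((\<lambda>u. F (c u)) has_field_derivative F' (c t)) (at t))" for F F' :: "cpoly \<Rightarrow> complex"
  have "\<exists>F'\<in>V. is_deriv F F'" if "F \<in> V" for F
  proof -
    from that have F: "F \<in> poly_funs coeff_funs" by (simp add: V_def)
    from poly_funs_derivative[OF this, of "\<lambda>x. x q"]
    obtain F' where F': "F' \<in> poly_funs coeff_funs" "is_deriv F F'"
      unfolding is_deriv_def by force
    have "F' (\<Sum>i<s. g i ^ k) = 0" if g: "g \<in> form_tuples n d s" "G g \<noteq> 0" for g
    proof -
      obtain h where "\<forall>i<s. h i \<in> forms n d" "q = (\<Sum>i<s. of_nat k * g i ^ (k - 1) * h i)"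
        using surj[OF g q] by blast
      then show ?thesis
        using vanishing_tangent_derivative[OF k G F _ _ g, of q F' h] F'(2) \<open>F \<in> V\<close>
        unfolding is_deriv_def V_def by blast
    qed
    with F' show ?thesis unfolding V_def by blast
  qed
  then obtain D where D: "\<And>F. F \<in> V \<Longrightarrow> D F \<in> V \<and> is_deriv F (D F)" by metis
  have FV: "(D ^^ j) F \<in> V" for j
    by (induction j) (use F D in \<open>auto simp: V_def power_sums_def\<close>)
  define c where "c t = p0 + cscale t q" for t
  have dc: "((\<lambda>u. Poly_Mapping.lookup (c u) m) has_field_derivative Poly_Mapping.lookup q m) (at t)" for m t
    unfolding c_def lookup_add lookup_cscale by (auto intro!: derivative_eq_intros)
  have "\<exists>P. \<forall>t. F (c t) = poly P t"
  proof (rule poly_funs_along_curve[OF F(1)])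
    fix x assume "x \<in> coeff_funs"
    then obtain m where x: "x = (\<lambda>g. Poly_Mapping.lookup g m)" by blast
    then show "\<exists>P. \<forall>t. x (c t) = poly P t"
      by (intro exI[of _ "[:Poly_Mapping.lookup p0 m, Poly_Mapping.lookup q m:]"])
         (simp add: c_def lookup_add)
  qed
  then obtain P where P: "F (c t) = poly P t" for t by blast
  have Pj: "(D ^^ j) F (c t) = poly ((pderiv ^^ j) P) t" for j t
  proof (induction j arbitrary: t)
    case 0
    show ?case by (simp add: P)
  next
    case (Suc j)
    have "((\<lambda>u. (D ^^ j) F (c u)) has_field_derivative (D ^^ Suc j) F (c t)) (at t)"
      using D[OF FV[of j]] dc unfolding is_deriv_def by simp
    moreover have "((\<lambda>u. (D ^^ j) F (c u)) has_field_derivative poly ((pderiv ^^ Suc j) P) t) (at t)"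
      using poly_DERIV[of "(pderiv ^^ j) P" t] by (simp add: Suc.IH)
    ultimately show ?case by (rule DERIV_unique)
  qed
  have "coeff P j = 0" for j
  proof -
    have "(D ^^ j) F p0 = 0" using FV[of j] g0 by (simp add: V_def p0_def)
    then have "coeff ((pderiv ^^ j) P) 0 = 0" using Pj[of j 0] by (simp add: c_def poly_0_coeff_0)
    then show ?thesis by (simp add: coeff_higher_pderiv pochhammer_fact[symmetric])
  qed
  then have "P = 0" by (intro poly_eqI) simp
  moreover have "c 1 = f" by (simp add: c_def q_def)
  ultimately show ?thesis using P[of 1] by simp
qed

lemma power_sums_subset: "power_sums k n d s \<subseteq> forms n (k * d)"
  unfolding power_sums_def form_tuples_def
  by (auto intro!: cpoly.subspace_sum[OF subspace_forms] forms_power)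

lemma subspace_gen_ideal: "cpoly.subspace (gen_ideal n s h)"
proof -
  have ring: "0 \<in> poly_ring n" "f \<in> poly_ring n \<Longrightarrow> g \<in> poly_ring n \<Longrightarrow> f + g \<in> poly_ring n"
    "f \<in> poly_ring n \<Longrightarrow> cscale c f \<in> poly_ring n" for f g c
    using keys_add[of f g] by (auto simp: poly_ring_def in_keys_iff)
  show ?thesis
  proof (rule cpoly.subspaceI)
    show "0 \<in> gen_ideal n s h"
      unfolding gen_ideal_def using ring by (intro CollectI exI[of _ "\<lambda>_. 0"]) auto
  next
    fix x y assume "x \<in> gen_ideal n s h" "y \<in> gen_ideal n s h"
    then obtain a b where "x = (\<Sum>i<s. a i * h i)" "y = (\<Sum>i<s. b i * h i)"
      "\<forall>i<s. a i \<in> poly_ring n" "\<forall>i<s. b i \<in> poly_ring n" unfolding gen_ideal_def by blast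
    then show "x + y \<in> gen_ideal n s h"
      unfolding gen_ideal_def using ring
      by (intro CollectI exI[of _ "\<lambda>i. a i + b i"]) (auto simp: sum.distrib distrib_right)
  next
    fix c x assume "x \<in> gen_ideal n s h"
    then obtain a where "x = (\<Sum>i<s. a i * h i)" "\<forall>i<s. a i \<in> poly_ring n"
      unfolding gen_ideal_def by blast
    then show "cscale c x \<in> gen_ideal n s h"
      unfolding gen_ideal_def using ring
      by (intro CollectI exI[of _ "\<lambda>i. cscale c (a i)"])
         (auto simp: cpoly.scale_sum_right cscale_mult_left)
  qed
qed

lemma gen_ideal_full_degree:
  assumes h: "\<And>i. i < s \<Longrightarrow> h i \<in> forms n e"
    and zero: "fps_nth (hilbert_series n (gen_ideal n s h)) (d + e) = 0"
    and q: "q \<in> forms n (d + e)"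
  shows "\<exists>a. (\<forall>i<s. a i \<in> forms n d) \<and> q = (\<Sum>i<s. a i * h i)"
proof -
  have "forms n (d + e) \<subseteq> gen_ideal n s h \<inter> forms n (d + e)"
    using zero unfolding hilbert_series_def
    by (intro cpoly.subset_of_dim_eq[OF _ _ forms_subset_span]
        cpoly.subspace_inter subspace_gen_ideal subspace_forms) auto
  with q obtain a where a: "q = (\<Sum>i<s. a i * h i)" "\<forall>i<s. a i \<in> poly_ring n"
    unfolding gen_ideal_def by blast
  have "q = hom_comp (d + e) q" using q by (simp add: hom_comp_form)
  also have "\<dots> = (\<Sum>i<s. hom_comp d (a i) * h i)"
    unfolding a(1) hom_comp_sum using h by (intro sum.cong refl hom_comp_mult_form) auto
  finally show ?thesis
    using a(2) by (intro exI[of _ "\<lambda>i. hom_comp d (a i)"]) (auto intro: hom_comp_in_forms)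
qed

text \<open>
  A zero coefficient of the Hilbert series means that the ideal contains all forms of degree
  \<open>k * d\<close>, that is, the differential of the power sum map is surjective.
\<close>

lemma dense_if_hilbert_zero:
  assumes k: "k \<ge> 1"
    and gen: "for_generic_forms n d s (\<lambda>g. hilbert_generic n s (\<lambda>i. d * (k - 1)) (\<lambda>i. g i ^ (k - 1)))"
    and zero: "fps_nth (truncate_nonpos ((\<Prod>i<s. 1 - fps_X ^ (d * (k - 1))) / (1 - fps_X) ^ n)) (k * d) = 0"
  shows "(forms_topology n (k * d)) closure_of (power_sums k n d s) = forms n (k * d)"
proof -
  have kd: "k * d = d + d * (k - 1)" using k by (cases k) (auto simp: algebra_simps)
  from gen obtain U where "openin (form_tuples_topology n d s) U" "U \<noteq> {}"
    and U: "\<And>g. g \<in> U \<Longrightarrow> hilbert_generic n s (\<lambda>i. d * (k - 1)) (\<lambda>i. g i ^ (k - 1))"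
    unfolding for_generic_forms_def by blast
  then obtain G g0 where G: "G \<in> poly_funs (tuple_coeff_funs s)"
    and g0: "g0 \<in> form_tuples n d s" "G g0 \<noteq> 0"
    and GU: "\<And>g. g \<in> form_tuples n d s \<Longrightarrow> G g \<noteq> 0 \<Longrightarrow> g \<in> U"
    unfolding form_tuples_topology_def openin_zariski zariski_open_iff by blast
  have "\<exists>h. (\<forall>i<s. h i \<in> forms n d) \<and> q = (\<Sum>i<s. of_nat k * g i ^ (k - 1) * h i)"
    if g: "g \<in> form_tuples n d s" "G g \<noteq> 0" and q: "q \<in> forms n (k * d)" for g q
  proof -
    have hg: "\<And>i. i < s \<Longrightarrow> g i ^ (k - 1) \<in> forms n (d * (k - 1))"
      "hilbert_series n (gen_ideal n s (\<lambda>i. g i ^ (k - 1))) =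
        truncate_nonpos ((\<Prod>i<s. 1 - fps_X ^ (d * (k - 1))) / (1 - fps_X) ^ n)"
      using U[OF GU[OF g]] unfolding hilbert_generic_def by blast+
    have "fps_nth (hilbert_series n (gen_ideal n s (\<lambda>i. g i ^ (k - 1)))) (d + d * (k - 1)) = 0"
      using zero unfolding hg(2) kd .
    from gen_ideal_full_degree[OF hg(1) this] q
    obtain a where a: "\<forall>i<s. a i \<in> forms n d" "q = (\<Sum>i<s. a i * g i ^ (k - 1))"
      unfolding kd by blast
    \<comment> \<open>The factor \<open>k\<close> of the differential is absorbed into \<open>h\<close>; it is invertible in characteristic 0.\<close>
    have scale_k: "of_nat k * f * cscale (1 / of_nat k) x = x * f" for f x :: cpoly
    proof -
      have "of_nat k * y = cscale (of_nat k) y" for y :: cpoly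
        by (simp add: cscale_def)
      then have "of_nat k * (f * cscale (1 / of_nat k) x) = cscale (of_nat k * (1 / of_nat k)) (f * x)"
        by (simp add: cscale_mult_right)
      then show ?thesis using k by (simp add: mult_ac)
    qed
    show ?thesis
    proof (intro exI[of _ "\<lambda>i. cscale (1 / of_nat k) (a i)"] conjI)
      show "q = (\<Sum>i<s. of_nat k * g i ^ (k - 1) * cscale (1 / of_nat k) (a i))"
        by (simp only: a(2) scale_k)
    qed (use a(1) cpoly.subspace_scale[OF subspace_forms] in blast)
  qed
  from vanishes_if_tangent_surjective[OF k G g0 this]
  have van: "F f = 0" if "F \<in> poly_funs coeff_funs" "\<forall>f\<in>power_sums k n d s. F f = 0"
      "f \<in> forms n (k * d)" for F f
    using that by blast
  from closure_of_eq_forms_iff[OF power_sums_subset] van show ?thesis by blast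
qed

section \<open>Algebraic dependence of few-parameter families\<close>

text \<open>
  The vectors form a family rather than a set: a repeated vector is itself a relation.
\<close>

lemma (in vector_space) linear_relation:
  assumes "finite A" "finite B" "card B < card A" and f: "\<And>a. a \<in> A \<Longrightarrow> f a \<in> span B"
  shows "\<exists>x. (\<exists>a\<in>A. x a \<noteq> 0) \<and> (\<Sum>a\<in>A. scale (x a) (f a)) = 0"
proof (cases "inj_on f A")
  case True
  have "dependent (f ` A)"
  proof (rule ccontr)
    assume "independent (f ` A)"
    then have "card (f ` A) \<le> card B"
      using independent_span_bound[of B "f ` A"] assms by auto
    with card_image[OF True] assms show False by simp
  qed
  then obtain u where u: "\<exists>v\<in>f ` A. u v \<noteq> 0" "(\<Sum>v\<in>f ` A. scale (u v) v) = 0"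
    using dependent_finite[of "f ` A"] assms(1) by auto
  then show ?thesis
    by (intro exI[of _ "u \<circ> f"]) (auto simp: sum.reindex[OF True])
next
  case False
  then obtain a b where ab: "a \<in> A" "b \<in> A" "a \<noteq> b" "f a = f b"
    unfolding inj_on_def by blast
  let ?x = "\<lambda>z. if z = a then 1 else if z = b then -1 else 0"
  have "(\<Sum>z\<in>A. scale (?x z) (f z)) = (\<Sum>z\<in>{a, b}. scale (?x z) (f z))"
    using ab assms(1) by (intro sum.mono_neutral_right) auto
  also have "\<dots> = 0" using ab by simp
  finally show ?thesis using ab by (intro exI[of _ ?x]) auto
qed

text \<open>
  Complex-valued functions form a complex vector space; its dimension theory carries the count of
  parameters.
\<close>

definition fscale :: "complex \<Rightarrow> ('x \<Rightarrow> complex) \<Rightarrow> 'x \<Rightarrow> complex" where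
  "fscale c f = (\<lambda>x. c * f x)"

interpretation func: vector_space "fscale :: complex \<Rightarrow> ('x \<Rightarrow> complex) \<Rightarrow> _"
  by unfold_locales (auto simp: fscale_def fun_eq_iff algebra_simps)

definition exponent_box :: "'j set \<Rightarrow> nat \<Rightarrow> ('j \<Rightarrow> nat) set" where
  "exponent_box J r = J \<rightarrow>\<^sub>E {..r}"

definition mono_fun :: "'j set \<Rightarrow> ('j \<Rightarrow> nat) \<Rightarrow> ('j \<Rightarrow> complex) \<Rightarrow> complex" where
  "mono_fun J e x = (\<Prod>j\<in>J. x j ^ e j)"

text \<open>
  Bounding the degree in each variable separately, rather than the total degree, makes the number
  of monomials a plain power, \<open>(r + 1) ^ card J\<close>.
\<close>

definition bounded_polys :: "'j set \<Rightarrow> nat \<Rightarrow> (('j \<Rightarrow> complex) \<Rightarrow> complex) set" where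
  "bounded_polys J r = func.span (mono_fun J ` exponent_box J r)"

lemma finite_exponent_box [simp]: "finite J \<Longrightarrow> finite (exponent_box J r)"
  by (simp add: exponent_box_def finite_PiE)

lemma card_exponent_box: "finite J \<Longrightarrow> card (exponent_box J r) = (r + 1) ^ card J"
  by (simp add: exponent_box_def card_PiE)

lemma bounded_polys_const [intro]: "(\<lambda>_. c) \<in> bounded_polys J r"
proof -
  have "fscale c (mono_fun J (\<lambda>j\<in>J. 0)) \<in> bounded_polys J r"
    unfolding bounded_polys_def
    by (intro func.span_scale func.span_base) (auto simp: exponent_box_def)
  moreover have "fscale c (mono_fun J (\<lambda>j\<in>J. 0)) = (\<lambda>_. c)"
    by (simp add: fscale_def mono_fun_def fun_eq_iff)
  ultimately show ?thesis by simp
qed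

lemma bounded_polys_var:
  assumes "finite J" "j \<in> J" "r \<ge> 1"
  shows "(\<lambda>x. x j) \<in> bounded_polys J r"
proof -
  let ?e = "\<lambda>i\<in>J. if i = j then 1 else 0"
  have "mono_fun J ?e \<in> bounded_polys J r"
    unfolding bounded_polys_def using assms by (intro func.span_base) (auto simp: exponent_box_def)
  moreover have "mono_fun J ?e = (\<lambda>x. x j)"
  proof
    fix x :: "'a \<Rightarrow> complex"
    have "mono_fun J ?e x = (\<Prod>i\<in>J. if i = j then x j else 1)"
      unfolding mono_fun_def by (intro prod.cong) auto
    then show "mono_fun J ?e x = x j" using assms by simp
  qed
  ultimately show ?thesis by simp
qed

lemma bounded_polys_add:
  "F \<in> bounded_polys J r \<Longrightarrow> G \<in> bounded_polys J r \<Longrightarrow> (\<lambda>x. F x + G x) \<in> bounded_polys J r"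
  unfolding bounded_polys_def using func.span_add[of F _ G] by (simp add: plus_fun_def)

lemma bounded_polys_scale: "F \<in> bounded_polys J r \<Longrightarrow> (\<lambda>x. c * F x) \<in> bounded_polys J r"
  unfolding bounded_polys_def using func.span_scale[of F _ c] by (simp add: fscale_def)

lemma bounded_polys_sum:
  "(\<And>a. a \<in> A \<Longrightarrow> F a \<in> bounded_polys J r) \<Longrightarrow> (\<lambda>x. \<Sum>a\<in>A. F a x) \<in> bounded_polys J r"
  by (induction A rule: infinite_finite_induct) (auto intro: bounded_polys_add)

lemma bounded_polys_mono: "r \<le> r' \<Longrightarrow> F \<in> bounded_polys J r \<Longrightarrow> F \<in> bounded_polys J r'"
proof -
  assume "r \<le> r'"
  then have "exponent_box J r \<subseteq> exponent_box J r'" unfolding exponent_box_def by (intro PiE_mono) auto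
  then have "bounded_polys J r \<subseteq> bounded_polys J r'"
    unfolding bounded_polys_def by (intro func.span_mono image_mono)
  then show "F \<in> bounded_polys J r \<Longrightarrow> F \<in> bounded_polys J r'" by blast
qed

lemma bounded_polys_mult:
  assumes "F \<in> bounded_polys J r" "G \<in> bounded_polys J r'"
  shows "(\<lambda>x. F x * G x) \<in> bounded_polys J (r + r')"
proof -
  have mono: "(\<lambda>x. mono_fun J e x * mono_fun J e' x) \<in> bounded_polys J (r + r')"
    if "e \<in> exponent_box J r" "e' \<in> exponent_box J r'" for e e'
  proof -
    have "(\<lambda>j\<in>J. e j + e' j) \<in> exponent_box J (r + r')"
      using that unfolding exponent_box_def restrict_PiE_iff by (auto simp: PiE_iff intro!: add_mono)
    then have "mono_fun J (\<lambda>j\<in>J. e j + e' j) \<in> bounded_polys J (r + r')"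
      unfolding bounded_polys_def by (intro func.span_base imageI)
    moreover have "mono_fun J (\<lambda>j\<in>J. e j + e' j) = (\<lambda>x. mono_fun J e x * mono_fun J e' x)"
      by (simp add: mono_fun_def fun_eq_iff power_add prod.distrib)
    ultimately show ?thesis by simp
  qed
  have 1: "(\<lambda>x. F x * mono_fun J e' x) \<in> bounded_polys J (r + r')" if e': "e' \<in> exponent_box J r'" for e'
    using assms(1) unfolding bounded_polys_def[of J r]
  proof (induction rule: func.span_induct_alt)
    case base
    then show ?case using bounded_polys_const[of 0] by simp
  next
    case (step c f g)
    then obtain e where "e \<in> exponent_box J r" "f = mono_fun J e" by blast
    then show ?case
      using bounded_polys_add[OF bounded_polys_scale[OF mono[OF _ e'], of e c] step.IH]
      by (simp add: fscale_def plus_fun_def algebra_simps)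
  qed
  show ?thesis
    using assms(2) unfolding bounded_polys_def[of J r']
  proof (induction rule: func.span_induct_alt)
    case base
    then show ?case using bounded_polys_const[of 0] by simp
  next
    case (step c f g)
    then obtain e where "e \<in> exponent_box J r'" "f = mono_fun J e" by blast
    then show ?case
      using bounded_polys_add[OF bounded_polys_scale[OF 1, of e c] step.IH]
      by (simp add: fscale_def plus_fun_def algebra_simps)
  qed
qed

lemma bounded_polys_power: "F \<in> bounded_polys J r \<Longrightarrow> (\<lambda>x. F x ^ k) \<in> bounded_polys J (k * r)"
  by (induction k) (auto dest: bounded_polys_mult[of F J r])

lemma bounded_polys_prod:
  "(\<And>a. a \<in> A \<Longrightarrow> F a \<in> bounded_polys J r) \<Longrightarrow> (\<lambda>x. \<Prod>a\<in>A. F a x) \<in> bounded_polys J (card A * r)"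
  by (induction A rule: infinite_finite_induct) (auto dest: bounded_polys_mult)

text \<open>
  An infinite field distinguishes polynomials by their values: splitting off one variable
  reduces this to polynomials in one variable.
\<close>

lemma mono_fun_independent:
  assumes "finite I" "\<And>y. (\<Sum>e\<in>exponent_box I r. c e * mono_fun I e y) = 0" "e \<in> exponent_box I r"
  shows "c e = 0"
  using assms
proof (induction I arbitrary: c e rule: finite_induct)
  case empty
  then show ?case by (simp add: exponent_box_def mono_fun_def)
next
  case (insert i I)
  have exponent_box_eq: "exponent_box (insert i I) r = (\<lambda>(k, e). e(i := k)) ` ({..r} \<times> exponent_box I r)"
    unfolding exponent_box_def by (simp add: PiE_insert_eq)
  have inj: "inj_on (\<lambda>(k, e). e(i := k)) ({..r} \<times> exponent_box I r)"
    unfolding exponent_box_def using inj_combinator[of i I "\<lambda>_. {..r}"] insert.hyps by simp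
  have mono: "mono_fun (insert i I) (e(i := k)) (y(i := t)) = t ^ k * mono_fun I e y" for e k y t
  proof -
    have "(\<Prod>j\<in>I. (y(i := t)) j ^ (e(i := k)) j) = (\<Prod>j\<in>I. y j ^ e j)"
      using insert.hyps by (intro prod.cong) auto
    then show ?thesis using insert.hyps by (simp add: mono_fun_def)
  qed
  have zero: "(\<Sum>e\<in>exponent_box I r. c (e(i := k)) * mono_fun I e y) = 0" if "k \<le> r" for k y
  proof -
    have "(\<Sum>k\<le>r. (\<Sum>e\<in>exponent_box I r. c (e(i := k)) * mono_fun I e y) * t ^ k) = 0" for t
    proof -
      have "0 = (\<Sum>e\<in>exponent_box (insert i I) r. c e * mono_fun (insert i I) e (y(i := t)))"
        using insert.prems(1) by simp
      also have "\<dots> = (\<Sum>(k, e)\<in>{..r} \<times> exponent_box I r. c (e(i := k)) * (t ^ k * mono_fun I e y))"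
        unfolding exponent_box_eq by (subst sum.reindex[OF inj]) (simp add: case_prod_unfold mono)
      also have "\<dots> = (\<Sum>k\<le>r. (\<Sum>e\<in>exponent_box I r. c (e(i := k)) * mono_fun I e y) * t ^ k)"
        by (simp add: sum.cartesian_product[symmetric] sum_distrib_left sum_distrib_right mult_ac)
      finally show ?thesis by simp
    qed
    then show ?thesis
      using polyfun_eq_0[of "\<lambda>k. \<Sum>e\<in>exponent_box I r. c (e(i := k)) * mono_fun I e y" r] that by blast
  qed
  obtain k e' where "e = e'(i := k)" "k \<le> r" "e' \<in> exponent_box I r"
    using insert.prems(2) unfolding exponent_box_eq by auto
  then show ?case using insert.IH[of "\<lambda>e. c (e(i := k))" e'] zero by blast
qed

text \<open>
  With \<open>N = card I\<close> and \<open>M = card J\<close>, there are \<open>(D + 1) ^ N\<close> monomials in the \<open>\<phi> i\<close> with exponents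
  at most \<open>D\<close>. They lie in a space of dimension at most \<open>(N * D * r + 1) ^ M\<close>, which is smaller for
  large \<open>D\<close> because \<open>M < N\<close>. A linear relation between them is the desired polynomial.
\<close>

lemma algebraic_relation:
  assumes fin: "finite I" "finite J" and less: "card J < card I"
    and \<phi>: "\<And>i. i \<in> I \<Longrightarrow> \<phi> i \<in> bounded_polys J r"
  shows "\<exists>F\<in>poly_funs ((\<lambda>i y. y i) ` I). (\<forall>x. F (\<lambda>i. \<phi> i x) = 0) \<and> (\<exists>y. F y \<noteq> 0)"
proof -
  define N M C where "N = card I" "M = card J" "C = N * r + 1"
  \<comment> \<open>With exponents at most \<open>D = C ^ M\<close>, the comparison reads \<open>(C * (D + 1)) ^ M < (D + 1) ^ Suc M\<close>.\<close>
  define D where "D = C ^ M"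
  define R where "R = N * (D * r)"
  define \<psi> where "\<psi> e x = (\<Prod>i\<in>I. \<phi> i x ^ e i)" for e x
  have "\<psi> e \<in> func.span (mono_fun J ` exponent_box J R)" if e: "e \<in> exponent_box I D" for e
  proof -
    have "(\<lambda>x. \<phi> i x ^ e i) \<in> bounded_polys J (D * r)" if i: "i \<in> I" for i
    proof (rule bounded_polys_mono[OF _ bounded_polys_power[OF \<phi>[OF i]]])
      show "e i * r \<le> D * r" using e i by (auto simp: exponent_box_def PiE_iff)
    qed
    then show ?thesis
      unfolding \<psi>_def bounded_polys_def[symmetric] R_def N_M_C_def(1) by (rule bounded_polys_prod)
  qed
  moreover have "card (mono_fun J ` exponent_box J R) < card (exponent_box I D)"
  proof -
    have "card (mono_fun J ` exponent_box J R) \<le> (R + 1) ^ M"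
      using card_image_le[of "exponent_box J R" "mono_fun J"] card_exponent_box[of J R] fin by (simp add: N_M_C_def)
    also have "R + 1 \<le> C * (D + 1)" by (simp add: R_def N_M_C_def algebra_simps)
    then have "(R + 1) ^ M \<le> (C * (D + 1)) ^ M" by (rule power_mono) simp
    also have "\<dots> = D * (D + 1) ^ M" by (simp only: D_def power_mult_distrib)
    also have "\<dots> < (D + 1) ^ Suc M" by simp
    also have "\<dots> \<le> (D + 1) ^ N"
      using less by (intro power_increasing) (auto simp: N_M_C_def)
    also have "\<dots> = card (exponent_box I D)" using card_exponent_box[of I D] fin by (simp add: N_M_C_def)
    finally show ?thesis .
  qed
  ultimately obtain c where c: "\<exists>e\<in>exponent_box I D. c e \<noteq> 0" "(\<Sum>e\<in>exponent_box I D. fscale (c e) (\<psi> e)) = 0"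
    using func.linear_relation[of "exponent_box I D" "mono_fun J ` exponent_box J R" \<psi>] fin by auto
  have sum_apply: "(\<Sum>e\<in>A. fscale (c e) (\<psi> e)) x = (\<Sum>e\<in>A. c e * \<psi> e x)" for A x
    by (induction A rule: infinite_finite_induct) (auto simp: fscale_def)
  define F where "F y = (\<Sum>e\<in>exponent_box I D. c e * mono_fun I e y)" for y
  have "F \<in> poly_funs ((\<lambda>i y. y i) ` I)"
    unfolding F_def mono_fun_def using fin
    by (intro poly_funs_sum poly_funs.mult poly_funs.const poly_funs_prod poly_funs_power)
       (auto intro: poly_funs.coord)
  moreover have "F (\<lambda>i. \<phi> i x) = 0" for x
    using c(2) sum_apply[of "exponent_box I D" x] by (simp add: F_def mono_fun_def \<psi>_def)
  moreover have "\<exists>y. F y \<noteq> 0"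
    using c(1) mono_fun_independent[OF fin(1), where c = c and r = D] unfolding F_def by blast
  ultimately show ?thesis by blast
qed

section \<open>Sums of fewer powers than the dimension allows\<close>

lemma poly_funs_coords_cong:
  assumes "F \<in> poly_funs ((\<lambda>i y. y i) ` I)" "\<And>i. i \<in> I \<Longrightarrow> y i = z i"
  shows "F y = F z"
  using assms by induction auto

lemma image_in_hypersurface:
  fixes \<psi> :: "('j \<Rightarrow> complex) \<Rightarrow> cpoly"
  assumes "finite J" "card J < card (monoms n e)"
    and coeff: "\<And>m. (\<lambda>x. Poly_Mapping.lookup (\<psi> x) m) \<in> bounded_polys J r"
  shows "\<exists>F\<in>poly_funs coeff_funs. (\<forall>x. F (\<psi> x) = 0) \<and> (\<exists>f\<in>forms n e. F f \<noteq> 0)"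
proof -
  obtain F y where F: "F \<in> poly_funs ((\<lambda>i y. y i) ` monoms n e)"
    "\<And>x. F (\<lambda>m. Poly_Mapping.lookup (\<psi> x) m) = 0" "F y \<noteq> 0"
    using algebraic_relation[OF finite_monoms assms(1,2), of "\<lambda>m x. Poly_Mapping.lookup (\<psi> x) m" r]
      coeff by blast
  let ?f = "\<Sum>m\<in>monoms n e. Poly_Mapping.single m (y m)"
  have "F (Poly_Mapping.lookup ?f) = F y"
    by (rule poly_funs_coords_cong[OF F(1)]) (simp add: lookup_sum_single)
  moreover have "?f \<in> forms n e"
    by (intro cpoly.subspace_sum[OF subspace_forms] single_in_forms)
  moreover have "(\<lambda>f. F (Poly_Mapping.lookup f)) \<in> poly_funs coeff_funs"
    using F(1) by (rule poly_funs_comp) (auto intro: poly_funs.coord)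
  ultimately show ?thesis using F(2,3)
    by (intro bexI[of _ "\<lambda>f. F (Poly_Mapping.lookup f)"] conjI bexI[of _ ?f] allI) auto
qed

text \<open>
  Irreducibility of the space of forms, checked on the line through a point where \<open>F\<close> and one where \<open>G\<close>
  does not vanish.
\<close>

lemma poly_funs_common_nonzero:
  assumes "F \<in> poly_funs coeff_funs" "G \<in> poly_funs coeff_funs"
    and "f \<in> forms n e" "F f \<noteq> 0" "g \<in> forms n e" "G g \<noteq> 0"
  shows "\<exists>h\<in>forms n e. F h * G h \<noteq> 0"
proof -
  define c where "c t = f + cscale t (g - f)" for t
  have ex: "\<exists>P. \<forall>t. H (c t) = poly P t" if "H \<in> poly_funs coeff_funs" for H
  proof (rule poly_funs_along_curve[OF that])
    fix x assume "x \<in> coeff_funs"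
    then obtain m where "x = (\<lambda>h. Poly_Mapping.lookup h m)" by blast
    then show "\<exists>P. \<forall>t. x (c t) = poly P t"
      by (intro exI[of _ "[:Poly_Mapping.lookup f m, Poly_Mapping.lookup (g - f) m:]"])
         (simp add: c_def lookup_add)
  qed
  from ex[OF assms(1)] ex[OF assms(2)]
  obtain P Q where PQ: "\<And>t. F (c t) = poly P t" "\<And>t. G (c t) = poly Q t"
    by blast
  have "c 0 = f" "c 1 = g" by (auto simp: c_def)
  then have "P \<noteq> 0" "Q \<noteq> 0" using assms(4,6) PQ(1)[of 0] PQ(2)[of 1] by auto
  then have "P * Q \<noteq> 0" by simp
  then obtain t where "poly (P * Q) t \<noteq> 0" using poly_all_0_iff_0 by blast
  then have "F (c t) * G (c t) \<noteq> 0" by (simp add: PQ)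
  moreover have "c t \<in> forms n e"
    unfolding c_def using assms(3,5) subspace_forms
    by (intro cpoly.subspace_add cpoly.subspace_scale cpoly.subspace_diff)
  ultimately show ?thesis by blast
qed

lemma union_in_hypersurface:
  assumes "finite Q"
    and "\<And>P. P \<in> Q \<Longrightarrow> \<exists>F\<in>poly_funs coeff_funs. (\<forall>f\<in>A P. F f = 0) \<and> (\<exists>f\<in>forms n e. F f \<noteq> 0)"
  shows "\<exists>F\<in>poly_funs coeff_funs. (\<forall>P\<in>Q. \<forall>f\<in>A P. F f = 0) \<and> (\<exists>f\<in>forms n e. F f \<noteq> 0)"
  using assms
proof (induction Q rule: finite_induct)
  case empty
  have "0 \<in> forms n e" by (rule cpoly.subspace_0[OF subspace_forms])
  then show ?case by (intro bexI[of _ "\<lambda>_. 1"]) (auto intro: poly_funs.const)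
next
  case (insert P Q)
  from insert.prems[OF insertI1] obtain F f where F: "F \<in> poly_funs coeff_funs" "\<forall>f\<in>A P. F f = 0"
    "f \<in> forms n e" "F f \<noteq> 0" by blast
  from insert.IH[OF insert.prems[OF insertI2]] obtain G g where G: "G \<in> poly_funs coeff_funs"
    "\<forall>P\<in>Q. \<forall>f\<in>A P. G f = 0" "g \<in> forms n e" "G g \<noteq> 0" by blast
  show ?case
    using poly_funs_common_nonzero[OF F(1) G(1) F(3,4) G(3,4)] F G
    by (intro bexI[of _ "\<lambda>p. F p * G p"]) (auto intro: poly_funs.mult)
qed

lemma not_dense_if_in_hypersurface:
  assumes "S \<subseteq> forms n e" "F \<in> poly_funs coeff_funs" "\<And>f. f \<in> S \<Longrightarrow> F f = 0"
    and "\<exists>f\<in>forms n e. F f \<noteq> 0"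
  shows "(forms_topology n e) closure_of S \<noteq> forms n e"
  using assms closure_of_eq_forms_iff[of S n e] by blast

lemma lookup_mult_bounded_polys:
  assumes "\<And>x. f x \<in> forms n d" "\<And>x. g x \<in> forms n e"
    and "\<And>m. (\<lambda>x. Poly_Mapping.lookup (f x) m) \<in> bounded_polys J r"
    and "\<And>m. (\<lambda>x. Poly_Mapping.lookup (g x) m) \<in> bounded_polys J r'"
  shows "(\<lambda>x. Poly_Mapping.lookup (f x * g x) m) \<in> bounded_polys J (r + r')"
proof -
  have "(\<lambda>x. if m = a + b then Poly_Mapping.lookup (f x) a * Poly_Mapping.lookup (g x) b else 0)
      \<in> bounded_polys J (r + r')" for a b
    by (cases "m = a + b") (auto intro: bounded_polys_mult assms(3,4))
  then show ?thesis unfolding lookup_mult_forms[OF assms(1,2)] by (intro bounded_polys_sum)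
qed

lemma lookup_power_bounded_polys:
  assumes f: "\<And>x. f x \<in> forms n d"
    and exponent_box: "\<And>m. (\<lambda>x. Poly_Mapping.lookup (f x) m) \<in> bounded_polys J r"
  shows "(\<lambda>x. Poly_Mapping.lookup (f x ^ k) m) \<in> bounded_polys J (k * r)"
proof (induction k arbitrary: m)
  case 0
  show ?case by simp (rule bounded_polys_const)
next
  case (Suc k)
  show ?case
    using lookup_mult_bounded_polys[where f = f, OF f forms_power[OF f] exponent_box Suc.IH] by simp
qed

lemma power_sums_not_dense:
  assumes less: "s * card (monoms n d) < card (monoms n (k * d))"
  shows "(forms_topology n (k * d)) closure_of (power_sums k n d s) \<noteq> forms n (k * d)"
proof -
  define J where "J = {..<s} \<times> monoms n d"
  define g where "g i x = (\<Sum>m\<in>monoms n d. Poly_Mapping.single m (x (i, m)))"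
    for i :: nat and x :: "nat \<times> (nat \<Rightarrow>\<^sub>0 nat) \<Rightarrow> complex"
  define \<psi> where "\<psi> x = (\<Sum>i<s. g i x ^ k)" for x
  have g_forms: "g i x \<in> forms n d" for i x
    unfolding g_def by (intro cpoly.subspace_sum[OF subspace_forms] single_in_forms)
  have g_box: "(\<lambda>x. Poly_Mapping.lookup (g i x) m) \<in> bounded_polys J 1" if "i < s" for i m
    using that by (cases "m \<in> monoms n d")
      (auto simp: g_def lookup_sum_single J_def intro!: bounded_polys_var)
  have "(\<lambda>x. Poly_Mapping.lookup (\<psi> x) m) \<in> bounded_polys J (k * 1)" for m
    unfolding \<psi>_def lookup_sum
    by (intro bounded_polys_sum lookup_power_bounded_polys[OF g_forms] g_box) simp
  moreover have "finite J" "card J < card (monoms n (k * d))"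
    using less by (auto simp: J_def)
  ultimately obtain F where F: "F \<in> poly_funs coeff_funs" "\<And>x. F (\<psi> x) = 0"
      "\<exists>f\<in>forms n (k * d). F f \<noteq> 0"
    using image_in_hypersurface[of J n "k * d" \<psi> "k * 1"] by blast
  have "F f = 0" if "f \<in> power_sums k n d s" for f
  proof -
    from that obtain h where h: "f = (\<Sum>i<s. h i ^ k)" "h \<in> form_tuples n d s"
      unfolding power_sums_def by blast
    have "f = \<psi> (\<lambda>(i, m). Poly_Mapping.lookup (h i) m)"
      unfolding h(1) \<psi>_def g_def using h(2)
      by (intro sum.cong refl arg_cong[of _ _ "\<lambda>x. x ^ k"])
         (auto simp: form_tuples_def intro: form_eq_sum)
    then show ?thesis using F(2) by simp
  qed
  then show ?thesis by (intro not_dense_if_in_hypersurface[OF power_sums_subset F(1) _ F(3)])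
qed

section \<open>Sums of squares\<close>

lemma (in vector_space) span_disjoint_independent:
  assumes "independent (A \<union> B)" "A \<inter> B = {}" "x \<in> span A" "x \<in> span B"
  shows "x = 0"
proof -
  have "representation (A \<union> B) x = representation A x" "representation (A \<union> B) x = representation B x"
    using assms by (auto intro: representation_extend)
  then have "representation A x b = 0" for b
    using representation_ne_zero[of A x b] representation_ne_zero[of B x b] assms(2) by auto
  moreover have "independent A" using assms(1) independent_mono by blast
  ultimately show ?thesis using sum_nonzero_representation_eq[of A x] assms(3) by simp
qed

text \<open>
  The reduced echelon form without coordinates. A basis of the span of \<open>T\<close> is completed by elements of
  \<open>B\<close>, and \<open>card B - s\<close> of these, the set \<open>Q\<close>, are set aside. The others span an \<open>s\<close>-dimensional space
  containing \<open>T\<close> and complementary to the span of \<open>Q\<close>; the vector \<open>u p\<close> is the projection of \<open>p\<close> to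
  that space, for each \<open>p\<close> in \<open>P = B - Q\<close>.
\<close>

lemma (in vector_space) pivot_basis:
  assumes B: "finite B" "independent B" and T: "finite T" "T \<subseteq> span B"
    and s: "card T \<le> s" "s \<le> card B"
  shows "\<exists>P u. P \<subseteq> B \<and> card P = s \<and> (\<forall>p\<in>P. p - u p \<in> span (B - P)) \<and> T \<subseteq> span (u ` P)"
proof -
  obtain T0 where T0: "T0 \<subseteq> T" "independent T0" "T \<subseteq> span T0"
    by (rule maximal_independent_subset)
  obtain C where C: "T0 \<subseteq> C" "C \<subseteq> T0 \<union> B" "independent C" "T0 \<union> B \<subseteq> span C"
    using maximal_independent_subset_extend[OF Un_upper1 T0(2)] by metis
  have "C \<subseteq> span B" using C(2) T0(1) T(2) span_superset by blast
  then have finC: "finite C" "card C \<le> card B" using independent_span_bound[OF B(1) C(3)] by auto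
  moreover have "card B \<le> card C" using independent_span_bound[OF finC(1) B(2)] C(4) by blast
  ultimately have cardC: "card C = card B" by simp
  have finT0: "finite T0" using T0(1) T(1) finite_subset by blast
  have "card B - s \<le> card (C - T0)"
    using card_Diff_subset[OF finT0 C(1)] card_mono[OF T(1) T0(1)] s cardC by simp
  then obtain Q where Q: "Q \<subseteq> C - T0" "card Q = card B - s"
    by (metis obtain_subset_with_card_n)
  define P where "P = B - Q"
  have QB: "Q \<subseteq> B" using Q(1) C(2) by blast
  then have BP: "B - P = Q" unfolding P_def by blast
  have cardP: "card P = s"
    using card_Diff_subset[of Q B] QB finite_subset[OF QB B(1)] Q(2) s by (simp add: P_def)
  have C_eq: "C = (C - Q) \<union> Q" using Q(1) by blast
  have "\<exists>w. w \<in> span (C - Q) \<and> p - w \<in> span Q" if "p \<in> P" for p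
  proof -
    have "p \<in> span ((C - Q) \<union> Q)" using that C(4) C_eq unfolding P_def by auto
    then obtain w z where "p = w + z" "w \<in> span (C - Q)" "z \<in> span Q" unfolding span_Un by blast
    then show ?thesis by (intro exI[of _ w]) simp
  qed
  then obtain u where u: "\<And>p. p \<in> P \<Longrightarrow> u p \<in> span (C - Q)" "\<And>p. p \<in> P \<Longrightarrow> p - u p \<in> span Q"
    by metis
  have "span (C - Q) \<subseteq> span (u ` P)"
  proof
    fix w assume w: "w \<in> span (C - Q)"
    have "span (C - Q) \<subseteq> span B" using \<open>C \<subseteq> span B\<close> by (intro span_minimal) auto
    with w have "w \<in> span (P \<union> Q)" using QB by (auto simp: P_def Un_absorb2)
    then obtain a b where ab: "w = a + b" "a \<in> span P" "b \<in> span Q" unfolding span_Un by blast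
    have "\<exists>a'\<in>span (u ` P). a - a' \<in> span Q" using ab(2)
    proof (induction rule: span_induct_alt)
      case base
      show ?case by (intro bexI[of _ 0]) (auto simp: span_zero)
    next
      case (step c p y)
      then obtain y' where y': "y' \<in> span (u ` P)" "y - y' \<in> span Q" by blast
      have "scale c p + y - (scale c (u p) + y') = scale c (p - u p) + (y - y')"
        by (simp add: scale_right_diff_distrib)
      also have "\<dots> \<in> span Q" using u(2)[OF step(1)] y'(2) by (intro span_add span_scale)
      finally show ?case
        using y'(1) step(1)
        by (intro bexI[of _ "scale c (u p) + y'"]) (auto intro: span_add span_scale span_base)
    qed
    then obtain a' where a': "a' \<in> span (u ` P)" "a - a' \<in> span Q" by blast
    have "span (u ` P) \<subseteq> span (C - Q)" using u(1) by (intro span_minimal) auto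
    then have "w - a' \<in> span (C - Q)" using w a'(1) span_diff by blast
    moreover have "w - a' \<in> span Q"
      using span_add[OF a'(2) ab(3)] ab(1) by (simp add: algebra_simps)
    ultimately have "w - a' = 0"
      using span_disjoint_independent[of "C - Q" Q "w - a'"] C(3) C_eq by auto
    then show "w \<in> span (u ` P)" using a'(1) by simp
  qed
  moreover have "T \<subseteq> span (C - Q)"
    using T0(3) C(1) Q(1) span_mono[of T0 "C - Q"] by blast
  ultimately show ?thesis
    using cardP u(2) by (intro exI[of _ P] exI[of _ u]) (auto simp: BP, simp add: P_def)
qed

lemma (in vector_space) span_image_finite:
  assumes "finite A" "x \<in> span (f ` A)"
  shows "\<exists>c. x = (\<Sum>a\<in>A. scale (c a) (f a))"
  using assms(2)
proof (induction rule: span_induct_alt)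
  case base
  show ?case by (intro exI[of _ "\<lambda>_. 0"]) simp
next
  case (step k v y)
  then obtain a c where a: "a \<in> A" "v = f a" and c: "y = (\<Sum>a\<in>A. scale (c a) (f a))" by blast
  have "(\<Sum>b\<in>A. scale (if b = a then k else 0) (f b)) = (\<Sum>b\<in>A. if b = a then scale k (f b) else 0)"
    by (intro sum.cong) auto
  moreover define c' where "c' = (\<lambda>b. (if b = a then k else 0) + c b)"
  ultimately have "scale k v + y = (\<Sum>b\<in>A. scale (c' b) (f b))"
    using a assms(1) by (simp add: scale_left_distrib sum.distrib c)
  then show ?case by (intro exI)
qed

definition ordered_pairs :: "'a :: linorder set \<Rightarrow> ('a \<times> 'a) set" where
  "ordered_pairs P = {(p, q) \<in> P \<times> P. p \<le> q}"

lemma finite_ordered_pairs [simp]: "finite P \<Longrightarrow> finite (ordered_pairs P)"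
  unfolding ordered_pairs_def by (rule finite_subset[of _ "P \<times> P"]) auto

lemma card_ordered_pairs:
  assumes "finite P"
  shows "2 * card (ordered_pairs P) = card P * (card P + 1)"
proof -
  let ?S = "ordered_pairs P" and ?S' = "prod.swap ` ordered_pairs P"
  have "?S \<union> ?S' = P \<times> P" "?S \<inter> ?S' = (\<lambda>p. (p, p)) ` P"
    by (force simp: ordered_pairs_def image_iff)+
  moreover have "card ((\<lambda>p. (p, p)) ` P) = card P"
    by (intro card_image) (auto simp: inj_on_def)
  moreover have "card ?S' = card ?S" by (intro card_image) auto
  ultimately show ?thesis using card_Un_Int[of ?S ?S'] assms by (simp add: card_cartesian_product)
qed

lemma keys_span_single:
  "z \<in> cpoly.span ((\<lambda>m. Poly_Mapping.single m 1) ` A) \<Longrightarrow> Poly_Mapping.keys z \<subseteq> A"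
proof (induction rule: cpoly.span_induct_alt)
  case (step c x y)
  then obtain m where "m \<in> A" "x = Poly_Mapping.single m 1" by blast
  then show ?case using step.IH keys_add[of "cscale c x" y] by (auto simp: cscale_single split: if_splits)
qed simp

lemma independent_singles:
  assumes "finite A"
  shows "cpoly.independent ((\<lambda>m. Poly_Mapping.single m 1) ` A)"
proof (rule cpoly.independent_if_scalars_zero)
  have inj: "inj_on (\<lambda>m. Poly_Mapping.single m (1::complex)) A"
    by (rule inj_onI) (metis keys_single singleton_inject zero_neq_one)
  fix f and x :: cpoly
  assume zero: "(\<Sum>x\<in>(\<lambda>m. Poly_Mapping.single m 1) ` A. cscale (f x) x) = 0"
    and "x \<in> (\<lambda>m. Poly_Mapping.single m 1) ` A"
  then obtain m where m: "m \<in> A" "x = Poly_Mapping.single m 1" by blast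
  from zero have "(\<Sum>m\<in>A. Poly_Mapping.single m (f (Poly_Mapping.single m 1))) = 0"
    by (simp add: sum.reindex[OF inj] cscale_single)
  then have "Poly_Mapping.lookup (\<Sum>m\<in>A. Poly_Mapping.single m (f (Poly_Mapping.single m 1))) m = 0"
    by simp
  then show "f x = 0" using m assms by (simp add: lookup_sum_single)
qed (use assms in simp)

text \<open>
  A row of a matrix in reduced echelon form: \<open>p\<close> is the pivot and \<open>R\<close> the set of all non-pivots.
\<close>

definition pivot_form ::
  "(nat \<Rightarrow>\<^sub>0 nat) set \<Rightarrow> ((nat \<Rightarrow>\<^sub>0 nat) \<Rightarrow> complex) \<Rightarrow> (nat \<Rightarrow>\<^sub>0 nat) \<Rightarrow> cpoly" where
  "pivot_form R a p = Poly_Mapping.single p 1 + (\<Sum>q\<in>R. Poly_Mapping.single q (a q))"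

lemma forms_in_pivot_span:
  assumes g: "\<And>i. i < s \<Longrightarrow> g i \<in> forms n d" and s: "s \<le> card (monoms n d)"
  shows "\<exists>P a. P \<subseteq> monoms n d \<and> card P = s \<and>
    (\<forall>i<s. g i \<in> cpoly.span ((\<lambda>p. pivot_form (monoms n d - P) (a p) p) ` P))"
proof -
  let ?e = "\<lambda>m. Poly_Mapping.single m (1::complex)" and ?M = "monoms n d"
  have inj: "inj ?e"
    by (rule injI) (metis keys_single singleton_inject zero_neq_one)
  have "card (g ` {..<s}) \<le> s" using card_image_le[of "{..<s}" g] by simp
  moreover have "g ` {..<s} \<subseteq> cpoly.span (?e ` ?M)" using g forms_subset_span by blast
  moreover have "card (?e ` ?M) = card ?M" using inj by (intro card_image) (auto simp: inj_on_def)
  ultimately have "\<exists>P' u. P' \<subseteq> ?e ` ?M \<and> card P' = s \<and>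
      (\<forall>p\<in>P'. p - u p \<in> cpoly.span (?e ` ?M - P')) \<and> g ` {..<s} \<subseteq> cpoly.span (u ` P')"
    using independent_singles[of ?M] s by (intro cpoly.pivot_basis) auto
  then obtain P' u where P': "P' \<subseteq> ?e ` ?M" "card P' = s"
      "\<And>p. p \<in> P' \<Longrightarrow> p - u p \<in> cpoly.span (?e ` ?M - P')" "g ` {..<s} \<subseteq> cpoly.span (u ` P')"
    by blast
  obtain P where P: "P \<subseteq> ?M" "P' = ?e ` P" using P'(1) by (auto simp: subset_image_iff)
  \<comment> \<open>\<open>?e p - u (?e p)\<close> is the part of \<open>p\<close> along the non-pivots, hence the sign.\<close>
  define a where "a p q = - Poly_Mapping.lookup (?e p - u (?e p)) q" for p q
  have diff: "?e ` ?M - P' = ?e ` (?M - P)" using image_set_diff[OF inj, of ?M P] P(2) by simp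
  have u: "u (?e p) = pivot_form (?M - P) (a p) p" if "p \<in> P" for p
  proof -
    have "Poly_Mapping.keys (?e p - u (?e p)) \<subseteq> ?M - P"
      using P'(3)[of "?e p"] P(2) that keys_span_single unfolding diff by blast
    then show ?thesis
      unfolding pivot_form_def
      by (intro poly_mapping_eqI)
         (force simp: lookup_add lookup_sum_single a_def lookup_minus in_keys_iff subset_iff)
  qed
  have "u ` P' = (\<lambda>p. pivot_form (?M - P) (a p) p) ` P"
    unfolding P(2) image_image by (intro image_cong refl u)
  moreover have "card P = s"
    using P'(2) card_image[OF inj_on_subset[OF inj subset_UNIV], of P] by (simp add: P(2))
  ultimately show ?thesis using P(1) P'(4) by (intro exI[of _ P] exI[of _ a]) auto
qed

lemma span_products:
  assumes "f \<in> cpoly.span (u ` P)" "g \<in> cpoly.span (u ` P)"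
  shows "f * g \<in> cpoly.span ((\<lambda>(p, q). u p * u q) ` ordered_pairs P)"
proof -
  let ?S = "cpoly.span ((\<lambda>(p, q). u p * u q) ` ordered_pairs P)"
  have base: "u p * u q \<in> ?S" if "p \<in> P" "q \<in> P" for p q
  proof (cases "p \<le> q")
    case True
    with that show ?thesis by (intro cpoly.span_base) (force simp: ordered_pairs_def)
  next
    case False
    then have "u q * u p \<in> ?S"
      using that by (intro cpoly.span_base) (force simp: ordered_pairs_def)
    then show ?thesis by (simp add: mult.commute)
  qed
  have 1: "u p * g \<in> ?S" if "p \<in> P" for p using assms(2)
  proof (induction rule: cpoly.span_induct_alt)
    case (step c x y)
    then have "cscale c (u p * x) + u p * y \<in> ?S"
      using base that by (intro cpoly.span_add cpoly.span_scale) auto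
    then show ?case by (simp add: distrib_left cscale_mult_right)
  qed (simp add: cpoly.span_zero)
  show ?thesis using assms(1)
  proof (induction rule: cpoly.span_induct_alt)
    case (step c x y)
    then have "cscale c (x * g) + y * g \<in> ?S"
      using 1 by (intro cpoly.span_add cpoly.span_scale) auto
    then show ?case by (simp add: distrib_right cscale_mult_left)
  qed (simp add: cpoly.span_zero)
qed

text \<open>
  For a fixed pivot set \<open>P\<close> there is one parameter for each entry outside the pivot columns and one for
  each product of two basis forms; the coefficients of the resulting form have degree at most 3 in
  the parameters together.
\<close>

lemma pivot_squares_in_hypersurface:
  fixes n d :: nat and P :: "(nat \<Rightarrow>\<^sub>0 nat) set"
  defines "R \<equiv> monoms n d - P"
  assumes P: "P \<subseteq> monoms n d"
    and less: "card P * card R + card (ordered_pairs P) < card (monoms n (2 * d))"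
  shows "\<exists>F\<in>poly_funs coeff_funs.
    (\<forall>f\<in>{f. \<exists>a. f \<in> cpoly.span ((\<lambda>(p, q). pivot_form R (a p) p * pivot_form R (a q) q) ` ordered_pairs P)}. F f = 0) \<and>
    (\<exists>f\<in>forms n (2 * d). F f \<noteq> 0)"
proof -
  have fin: "finite P" "finite R" using P finite_subset[OF P] by (auto simp: R_def)
  \<comment> \<open>\<open>Inl\<close> indexes the entries of the echelon matrix, \<open>Inr\<close> the coefficients of the quadratic form.\<close>
  define J where "J = Inl ` (P \<times> R) \<union> Inr ` ordered_pairs P"
  define u where "u p x = pivot_form R (\<lambda>q. x (Inl (p, q))) p" for p
    and x :: "((nat \<Rightarrow>\<^sub>0 nat) \<times> (nat \<Rightarrow>\<^sub>0 nat)) + ((nat \<Rightarrow>\<^sub>0 nat) \<times> (nat \<Rightarrow>\<^sub>0 nat)) \<Rightarrow> complex"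
  define \<psi> where "\<psi> x = (\<Sum>(p, q)\<in>ordered_pairs P. cscale (x (Inr (p, q))) (u p x * u q x))" for x
  have finJ: "finite J" using fin by (simp add: J_def)
  have "card J = card P * card R + card (ordered_pairs P)"
    unfolding J_def using fin
    by (subst card_Un_disjoint) (auto simp: card_image card_cartesian_product)
  with less have cardJ: "card J < card (monoms n (2 * d))" by simp
  have u_forms: "u p x \<in> forms n d" if "p \<in> P" for p x
    using that P unfolding u_def pivot_form_def R_def
    by (intro cpoly.subspace_add[OF subspace_forms] cpoly.subspace_sum[OF subspace_forms]
        single_in_forms) auto
  have u_box: "(\<lambda>x. Poly_Mapping.lookup (u p x) m) \<in> bounded_polys J 1" if "p \<in> P" for p m
  proof -
    have "(\<lambda>x. if m \<in> R then x (Inl (p, m)) else 0) \<in> bounded_polys J 1"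
      using that finJ by (cases "m \<in> R") (auto simp: J_def intro!: bounded_polys_var)
    then show ?thesis
      unfolding u_def pivot_form_def lookup_add lookup_sum_single[OF fin(2)]
      by (intro bounded_polys_add bounded_polys_const)
  qed
  have \<psi>_box: "(\<lambda>x. Poly_Mapping.lookup (\<psi> x) m) \<in> bounded_polys J 3" for m
  proof -
    have "(\<lambda>x. x (Inr pq) * Poly_Mapping.lookup (u (fst pq) x * u (snd pq) x) m)
        \<in> bounded_polys J (1 + (1 + 1))" if pq: "pq \<in> ordered_pairs P" for pq
    proof (rule bounded_polys_mult)
      show "(\<lambda>x. x (Inr pq)) \<in> bounded_polys J 1"
        using pq finJ by (intro bounded_polys_var) (auto simp: J_def)
      have "fst pq \<in> P" "snd pq \<in> P" using pq by (auto simp: ordered_pairs_def)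
      then show "(\<lambda>x. Poly_Mapping.lookup (u (fst pq) x * u (snd pq) x) m) \<in> bounded_polys J (1 + 1)"
        by (intro lookup_mult_bounded_polys[of "u (fst pq)" n d "u (snd pq)" d] u_forms u_box)
    qed
    then show ?thesis
      unfolding \<psi>_def lookup_sum case_prod_unfold lookup_cscale
      by (intro bounded_polys_sum) (simp add: numeral_3_eq_3)
  qed
  obtain F where F: "F \<in> poly_funs coeff_funs" "\<And>x. F (\<psi> x) = 0"
      "\<exists>f\<in>forms n (2 * d). F f \<noteq> 0"
    using image_in_hypersurface[OF finJ cardJ \<psi>_box] by blast
  have "F f = 0" if f: "f \<in> cpoly.span
      ((\<lambda>(p, q). pivot_form R (a p) p * pivot_form R (a q) q) ` ordered_pairs P)" for f a
  proof -
    obtain c where "f = (\<Sum>pq\<in>ordered_pairs P.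
        cscale (c pq) ((\<lambda>(p, q). pivot_form R (a p) p * pivot_form R (a q) q) pq))"
      using cpoly.span_image_finite[OF finite_ordered_pairs[OF fin(1)] f] by blast
    then have "f = \<psi> (case_sum (\<lambda>(p, q). a p q) c)"
      by (simp add: \<psi>_def u_def case_prod_unfold)
    then show ?thesis using F(2) by simp
  qed
  then show ?thesis using F(1,3) by (intro bexI[of _ F]) auto
qed

lemma square_sums_not_dense:
  assumes s: "s \<le> card (monoms n d)"
    and less: "s * (card (monoms n d) - s) + s * (s + 1) div 2 < card (monoms n (2 * d))"
  shows "(forms_topology n (2 * d)) closure_of (power_sums 2 n d s) \<noteq> forms n (2 * d)"
proof -
  let ?M = "monoms n d"
  define Q where "Q = {P. P \<subseteq> ?M \<and> card P = s}"
  define A where "A P = {f. \<exists>a. f \<in> cpoly.span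
    ((\<lambda>(p, q). pivot_form (?M - P) (a p) p * pivot_form (?M - P) (a q) q) ` ordered_pairs P)}" for P
  have "finite Q" unfolding Q_def by simp
  moreover have "\<exists>F\<in>poly_funs coeff_funs. (\<forall>f\<in>A P. F f = 0) \<and> (\<exists>f\<in>forms n (2 * d). F f \<noteq> 0)"
    if P: "P \<in> Q" for P
  proof -
    have finP: "finite P" using P finite_subset[OF _ finite_monoms] by (auto simp: Q_def)
    have "card (?M - P) = card ?M - s" using P finP by (simp add: Q_def card_Diff_subset)
    moreover have "card (ordered_pairs P) = s * (s + 1) div 2"
      using card_ordered_pairs[OF finP] P by (simp add: Q_def)
    ultimately show ?thesis
      unfolding A_def using less P by (intro pivot_squares_in_hypersurface) (auto simp: Q_def)
  qed
  ultimately obtain F where F: "F \<in> poly_funs coeff_funs" "\<forall>P\<in>Q. \<forall>f\<in>A P. F f = 0"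
      "\<exists>f\<in>forms n (2 * d). F f \<noteq> 0"
    using union_in_hypersurface[of Q A n "2 * d"] by blast
  have "F f = 0" if "f \<in> power_sums 2 n d s" for f
  proof -
    from that obtain g where g: "f = (\<Sum>i<s. g i ^ 2)" "\<And>i. i < s \<Longrightarrow> g i \<in> forms n d"
      unfolding power_sums_def form_tuples_def by (auto simp: PiE_iff)
    from forms_in_pivot_span[of s g, OF g(2) s] obtain P a where P: "P \<in> Q"
      "\<forall>i<s. g i \<in> cpoly.span ((\<lambda>p. pivot_form (?M - P) (a p) p) ` P)"
      unfolding Q_def by blast
    then have "f \<in> A P"
      unfolding A_def g(1) power2_eq_square by (auto intro!: exI[of _ a] cpoly.span_sum span_products)
    then show ?thesis using F(2) P(1) by blast
  qed
  then show ?thesis by (intro not_dense_if_in_hypersurface[OF power_sums_subset F(1) _ F(3)])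
qed

text \<open>
  Every monomial of degree \<open>2 * d\<close> is a product of two monomials of degree \<open>d\<close>, in some order.
\<close>

lemma card_monoms_double:
  "card (monoms n (2 * d)) \<le> card (monoms n d) * (card (monoms n d) + 1) div 2"
proof -
  let ?M = "monoms n d"
  have "monoms n (2 * d) \<subseteq> (\<lambda>(p, q). p + q) ` ordered_pairs ?M"
  proof
    fix m assume "m \<in> monoms n (2 * d)"
    then obtain p q where pq: "p \<in> ?M" "q \<in> ?M" "m = p + q"
      using monoms_split[of m n d d] by (auto simp: mult_2)
    then have "(p, q) \<in> ordered_pairs ?M \<or> (q, p) \<in> ordered_pairs ?M"
      by (auto simp: ordered_pairs_def)
    then show "m \<in> (\<lambda>(p, q). p + q) ` ordered_pairs ?M"
      using pq(3) by (force simp: add.commute)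
  qed
  then have "card (monoms n (2 * d)) \<le> card (ordered_pairs ?M)"
    by (rule surj_card_le[OF finite_ordered_pairs[OF finite_monoms]])
  then show ?thesis using card_ordered_pairs[OF finite_monoms, of n d] by linarith
qed

section \<open>Coefficients of the expected Hilbert series\<close>

lemma nth_inverse_one_minus_X_power:
  assumes "n \<ge> 1"
  shows "fps_nth (inverse ((1 - fps_X) ^ n) :: real fps) j = real ((j + n - 1) choose (n - 1))"
proof -
  have "inverse ((1 - fps_X) ^ n) = Abs_fps (\<lambda>k. real ((n + k - 1) choose k) * 1 ^ k)"
    using one_minus_const_fps_X_neg_power'[of n "1::real"] assms by simp
  then have "fps_nth (inverse ((1 - fps_X) ^ n) :: real fps) j = real ((j + n - 1) choose j)"
    by (simp add: add.commute)
  also have "(j + n - 1) choose j = (j + n - 1) choose (n - 1)"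
    using assms binomial_symmetric[of j "j + n - 1"] by simp
  finally show ?thesis .
qed

text \<open>
  The series whose truncation a Hilbert generic ideal with \<open>s\<close> generators of degree \<open>e\<close> attains.
\<close>

definition expected_series :: "nat \<Rightarrow> nat \<Rightarrow> nat \<Rightarrow> real fps" where
  "expected_series n e s = (\<Prod>i<s. 1 - fps_X ^ e) / (1 - fps_X) ^ n"

lemma expected_series_eq: "expected_series n e s = (1 - fps_X ^ e) ^ s * inverse ((1 - fps_X) ^ n)"
  unfolding expected_series_def by (subst fps_divide_unit) auto

lemma nth_expected_series_Suc:
  "fps_nth (expected_series n e (Suc s)) j = fps_nth (expected_series n e s) j -
     (if j < e then 0 else fps_nth (expected_series n e s) (j - e))"
proof -
  have "expected_series n e (Suc s) = expected_series n e s - fps_X ^ e * expected_series n e s"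
    by (simp add: expected_series_eq algebra_simps)
  then show ?thesis by (simp add: fps_X_power_mult_nth)
qed

lemma nth_expected_series_0:
  "n \<ge> 1 \<Longrightarrow> fps_nth (expected_series n e 0) j = real ((j + n - 1) choose (n - 1))"
  using nth_inverse_one_minus_X_power[of n j] by (simp add: expected_series_eq)

lemma nth_expected_series_low:
  "n \<ge> 1 \<Longrightarrow> j < e \<Longrightarrow> fps_nth (expected_series n e s) j = real ((j + n - 1) choose (n - 1))"
  by (induction s) (simp_all add: nth_expected_series_0 nth_expected_series_Suc)

text \<open>
  Below degree \<open>2 * e\<close> the Koszul relations between the generators do not contribute yet.
\<close>

lemma nth_expected_series_mid:
  assumes "n \<ge> 1" "j < e"
  shows "fps_nth (expected_series n e s) (j + e) =
    real ((j + e + n - 1) choose (n - 1)) - real s * real ((j + n - 1) choose (n - 1))"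
  using assms
  by (induction s)
     (simp_all add: nth_expected_series_0 nth_expected_series_Suc nth_expected_series_low
       algebra_simps)

text \<open>
  In degree \<open>2 * e\<close> each pair of generators contributes one Koszul relation.
\<close>

lemma nth_expected_series_double:
  assumes "n \<ge> 1" "e \<ge> 1"
  shows "fps_nth (expected_series n e s) (2 * e) =
    real ((2 * e + n - 1) choose (n - 1)) - real s * real ((e + n - 1) choose (n - 1))
      + real (s choose 2)"
proof (induction s)
  case 0
  show ?case using assms by (simp add: nth_expected_series_0 binomial_eq_0)
next
  case (Suc s)
  have "fps_nth (expected_series n e s) e = real ((e + n - 1) choose (n - 1)) - real s"
    using nth_expected_series_mid[of n 0 e s] assms by simp
  moreover have "Suc s choose 2 = s + (s choose 2)" by (simp add: numeral_2_eq_2)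
  ultimately show ?case
    using Suc.IH assms by (simp add: nth_expected_series_Suc algebra_simps mult_2)
qed

lemma truncate_nonpos_nth_eq_0: "fps_nth a j \<le> 0 \<Longrightarrow> fps_nth (truncate_nonpos a) j = 0"
  by (auto simp: truncate_nonpos_def intro!: exI[of _ j])

lemma square_count:
  assumes "s \<le> N"
  shows "int (s * (N - s) + s * (s + 1) div 2) = int s * int N - int (s choose 2)"
proof -
  obtain t where t: "N = s + t" using assms le_Suc_ex by blast
  have "s * (s + 1) div 2 = s + (s choose 2)"
    using choose_two[of "Suc s"] by (simp add: numeral_2_eq_2 mult.commute)
  moreover have "s + 2 * (s choose 2) = s * s"
    using choose_two[of s] by (cases s) (auto simp: algebra_simps)
  then have "int s + 2 * int (s choose 2) = int s * int s" by (metis of_nat_add of_nat_mult of_nat_numeral)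
  ultimately show ?thesis by (simp add: t algebra_simps)
qed

section \<open>The generic rank\<close>

theorem theoremA3:
  assumes C: "\<forall>n k d s. n \<ge> 2 \<and> k \<ge> 2 \<and> d > 1 \<and> s \<ge> 1 \<longrightarrow>
      for_generic_forms n d s
        (\<lambda>g. hilbert_generic n s (\<lambda>i. d * (k - 1)) (\<lambda>i. g i ^ (k - 1)))"
  shows "\<forall>k n d. k \<ge> 2 \<and> n \<ge> 2 \<and> d \<ge> 2 \<longrightarrow>
      generic_rank k n d =
        (if k = 2
         then (LEAST s. s \<ge> 1 \<and>
                int s * int ((d + n - 1) choose (n - 1)) - int (s choose 2)
                  \<ge> int ((2 * d + n - 1) choose (n - 1)))
         else (LEAST s. s \<ge> 1 \<and>
                s * ((d + n - 1) choose (n - 1)) \<ge> ((k * d + n - 1) choose (n - 1))))"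
proof (intro allI impI)
  fix k n d :: nat
  assume knd: "k \<ge> 2 \<and> n \<ge> 2 \<and> d \<ge> 2"
  define dense where "dense s \<longleftrightarrow>
    (forms_topology n (k * d)) closure_of (power_sums k n d s) = forms n (k * d)" for s
  define N where "N j = ((j + n - 1) choose (n - 1))" for j
  have N: "N j = card (monoms n j)" "N j \<ge> 1" for j
    using card_monoms[of n j] knd by (auto simp: N_def Suc_le_eq)
  have denseI: "dense s"
    if "s \<ge> 1" "fps_nth (expected_series n (d * (k - 1)) s) (k * d) \<le> 0" for s
  proof -
    have "for_generic_forms n d s
        (\<lambda>g. hilbert_generic n s (\<lambda>i. d * (k - 1)) (\<lambda>i. g i ^ (k - 1)))"
      using C knd that(1) by auto
    then show ?thesis
      unfolding dense_def
      using truncate_nonpos_nth_eq_0[OF that(2)] knd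
      by (intro dense_if_hilbert_zero) (auto simp: expected_series_def)
  qed
  have rank: "generic_rank k n d = s" if "dense s" "\<And>r. r < s \<Longrightarrow> \<not> dense r" for s
    unfolding generic_rank_def dense_def[symmetric] using that
    by (intro Least_equality) (auto simp: not_less[symmetric])
  show "generic_rank k n d =
        (if k = 2
         then (LEAST s. s \<ge> 1 \<and>
                int s * int ((d + n - 1) choose (n - 1)) - int (s choose 2)
                  \<ge> int ((2 * d + n - 1) choose (n - 1)))
         else (LEAST s. s \<ge> 1 \<and>
                s * ((d + n - 1) choose (n - 1)) \<ge> ((k * d + n - 1) choose (n - 1))))"
  proof (cases "k = 2")
    case False
    define Q where "Q s \<longleftrightarrow> s \<ge> 1 \<and> s * N d \<ge> N (k * d)" for s
    define s where "s = (LEAST s. Q s)"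
    have "Q (N (k * d))" using N(2)[of d] N(2)[of "k * d"] by (simp add: Q_def)
    then have Qs: "Q s" unfolding s_def by (rule LeastI)
    have "\<not> dense r" if "r < s" for r
    proof -
      have "\<not> Q r" using that not_less_Least unfolding s_def by blast
      then have "r * N d < N (k * d)" using N(2)[of "k * d"] by (cases "r = 0") (auto simp: Q_def)
      then show ?thesis unfolding dense_def by (intro power_sums_not_dense) (simp add: N(1))
    qed
    moreover have "dense s"
    proof (rule denseI)
      have "k * d = d + d * (k - 1)" using knd by (cases k) (auto simp: algebra_simps)
      moreover have "1 < k - 1" using False knd by arith
      then have "d < d * (k - 1)" using knd by simp
      ultimately have "fps_nth (expected_series n (d * (k - 1)) s) (k * d)
          = real (N (k * d)) - real s * real (N d)"
        using nth_expected_series_mid[of n d "d * (k - 1)" s] knd by (simp add: N_def)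
      also have "\<dots> \<le> 0" using Qs by (simp add: Q_def flip: of_nat_mult)
      finally show "fps_nth (expected_series n (d * (k - 1)) s) (k * d) \<le> 0" .
    qed (use Qs in \<open>simp add: Q_def\<close>)
    ultimately have "generic_rank k n d = s" by (rule rank[rotated])
    then show ?thesis using False by (simp add: s_def Q_def N_def)
  next
    case True
    define Q where "Q s \<longleftrightarrow> s \<ge> 1 \<and> int s * int (N d) - int (s choose 2) \<ge> int (N (2 * d))" for s
    define s where "s = (LEAST s. Q s)"
    have "N (2 * d) \<le> N d * (N d + 1) div 2" using card_monoms_double[of n d] by (simp add: N(1))
    then have QN: "Q (N d)"
      using square_count[of "N d" "N d"] N(2)[of d] unfolding Q_def by simp
    then have Qs: "Q s" unfolding s_def by (rule LeastI)
    have "s \<le> N d" unfolding s_def using QN by (rule Least_le)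
    have "\<not> dense r" if "r < s" for r
    proof -
      have r: "r \<le> N d" using that \<open>s \<le> N d\<close> by simp
      have "\<not> Q r" using that not_less_Least unfolding s_def by blast
      then have "int r * int (N d) - int (r choose 2) < int (N (2 * d))"
        using N(2)[of "2 * d"] by (cases "r = 0") (auto simp: Q_def)
      then have "r * (N d - r) + r * (r + 1) div 2 < N (2 * d)"
        unfolding square_count[OF r, symmetric] by (simp only: of_nat_less_iff)
      then show ?thesis
        unfolding dense_def True using r by (intro square_sums_not_dense) (simp_all add: N(1))
    qed
    moreover have "dense s"
    proof (rule denseI)
      have "fps_nth (expected_series n (d * (k - 1)) s) (k * d)
          = real (N (2 * d)) - real s * real (N d) + real (s choose 2)"
        using nth_expected_series_double[of n d s] knd True by (simp add: N_def)
      also have "\<dots> = real_of_int (int (N (2 * d)) - int s * int (N d) + int (s choose 2))" by simp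
      also have "\<dots> \<le> real_of_int 0" using Qs unfolding Q_def of_int_le_iff by linarith
      finally show "fps_nth (expected_series n (d * (k - 1)) s) (k * d) \<le> 0" by simp
    qed (use Qs in \<open>simp add: Q_def\<close>)
    ultimately have "generic_rank k n d = s" by (rule rank[rotated])
    then show ?thesis using True by (simp add: s_def Q_def N_def)
  qed
qed

end
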